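(* Let $d,m\ge 1$ be integers, let $1<p_1,\dots,p_m<\infty$, let $p\in(0,\infty)$ be given by $\frac1p=\frac1{p_1}+\dots+\frac1{p_m}$, write $\overrightarrow p=(p_1,\dots,p_m)$, and let $1<\rho<\infty$. There is a constant $D=D_{d,\overrightarrow p,\rho}\in(1,\infty)$, depending only on $d,\overrightarrow p,\rho$, and constants $C_1,C_2\in(0,\infty)$, depending only on $d,\overrightarrow p,\rho$, such that for all weights $\omega,\sigma_1,\dots,\sigma_m$ on $\mathbb R^d$ for which $\overrightarrow\sigma=(\sigma_1,\dots,\sigma_m)$ satisfies the $RH_{\overrightarrow p}$ condition (that is, $[\overrightarrow\sigma]_{RH_{\overrightarrow p}}<\infty$), we have $$[\omega,\overrightarrow\sigma]_{A_{\overrightarrow p}}+\overrightarrow{\mathfrak P}_{\overrightarrow p,\rho,D}\le C_1\,\mathcal N(\omega,\overrightarrow\sigma)$$ and $$\mathcal N(\omega,\overrightarrow\sigma)\le C_2\left([\omega,\overrightarrow\sigma]_{A_{\overrightarrow p}}+\overrightarrow{\mathfrak P}_{\overrightarrow p,\rho,D}\right)[\overrightarrow\sigma]_{RH_{\overrightarrow p}},$$ where $\mathcal N(\omega,\overrightarrow\sigma)=\lVert\mathcal M(\overrightarrow{\sigma\,\cdot})\rVert_{\prod_{i=1}^m L^{p_i}(\sigma_i)\to L^p(\omega)}$ denotes the smallest constant $C\in[0,\infty]$ such that $$\lVert\mathcal M(f_1\sigma_1,\dots,f_m\sigma_m)\rVert_{L^p(\omega)}^p\le C\prod_{i=1}^m\lVert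 f_i\rVert_{L^{p_i}(\sigma_i)}^p\qquad\text{for all } f_i\in L^{p_i}(\sigma_i),\ 1\le i\le m.$$
   Context: All cubes $Q\subset\mathbb R^d$ have sides parallel to the coordinate axes; $|Q|$ is the Lebesgue measure of $Q$ and $\ell(Q)=|Q|^{1/d}$ its side length. A weight is a nonnegative locally integrable function on $\mathbb R^d$; for a weight $\sigma$ and a measurable set $E$, $\sigma(E)=\int_E\sigma\,dx$, and $L^q(\sigma)$ is the $L^q$ space with respect to the measure $\sigma\,dx$. The multilinear maximal operator is $$\mathcal M(f_1,\dots,f_m)(x)=\sup_{Q\ni x}\prod_{i=1}^m\frac1{|Q|}\int_Q|f_i(y_i)|\,dy_i,\qquad x\in\mathbb R^d,$$ the supremum being over all cubes $Q$ containing $x$. Let $p_i'=p_i/(p_i-1)$. For weights $\omega,\sigma_1,\dots,\sigma_m$ and $\overrightarrow\sigma=(\sigma_1,\dots,\sigma_m)$: (1) $A_{\overrightarrow p}$ constant: $$[\omega,\overrightarrow\sigma]_{A_{\overrightarrow p}}=\sup_Q\Big(\frac1{|Q|}\int_Q\omega\,dx\Big)\prod_{i=1}^m\Big(\frac1{|Q|}\int_Q\sigma_i\,dx\Big)^{p/p_i'},$$ the supremum over all cubes $Q$. (2) Reverse Hölder condition $RH_{\overrightarrow p}$: $\overrightarrow\sigma$ satisfies $RH_{\overrightarrow p}$ if there is a finite constant $C$ such that for every cube $Q$ $$\prod_{i=1}^m\Big(\int_Q\sigma_i\,dx\Big)^{p/p_i}\le C\int_Q\prod_{i=1}^m\sigma_i^{p/p_i}\,dx;$$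 $[\overrightarrow\sigma]_{RH_{\overrightarrow p}}$ is the smallest such $C$. (3) Parent doubling testing constant: for $1<\rho,D<\infty$, $\overrightarrow{\mathfrak P}_{\overrightarrow p,\rho,D}=\overrightarrow{\mathfrak P}(\omega,\overrightarrow\sigma,d,\overrightarrow p,\rho,D)$ is the smallest constant $\mathfrak P\in[0,\infty]$ such that $$\int_Q\mathcal M(\sigma_1\mathbf 1_Q,\dots,\sigma_m\mathbf 1_Q)^p\,\omega\,dx\le\mathfrak P\prod_{i=1}^m\sigma_i(Q)^{p/p_i}$$ for every cube $Q$ for which there exist a cube $P\supset Q$ and an index $1\le i\le m$ with $\ell(P)\ge\rho\,\ell(Q)$ and $\sigma_i(P)\le D\,\sigma_i(Q)$. (Only such cubes $Q$ are tested.) The quantities in (1), (3) and $\mathcal N(\omega,\overrightarrow\sigma)$ may be $+\infty$; the inequalities are understood in $[0,\infty]$. *)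

theory Defs
  imports "HOL-Analysis.Analysis"
begin

text \<open>
  Points live in \<^typ>\<open>real ^ 'd\<close>, so \<open>d = CARD('d)\<close>, and the \<open>m\<close> functions, weights and exponents are
  indexed by a finite type \<open>'m\<close>. Quantities that may be infinite are of type \<^typ>\<open>ennreal\<close>
  (where \<open>0 * \<infinity> = 0\<close>). A constant described as the smallest one for which a family of inequalities
  holds is an infimum in \<^typ>\<open>ennreal\<close>, with \<open>Inf {} = \<infinity>\<close>.
\<close>

text \<open>The value at \<open>\<infinity>\<close> is the intended one for \<open>r > 0\<close>; no other exponents are used.\<close>

definition ennreal_powr :: "ennreal \<Rightarrow> real \<Rightarrow> ennreal" (infixr "epowr" 80) where
  "x epowr r = (if x = \<infinity> then \<infinity> else ennreal (enn2real x powr r))"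

text \<open>Cubes are closed and nondegenerate.\<close>

definition cubes :: "(real ^ 'd) set set" where
  "cubes = {cbox a (a + vec l) | a l. 0 < l}"

definition side_length :: "(real ^ 'd) set \<Rightarrow> real" where
  "side_length Q = measure lebesgue Q powr (1 / real CARD('d))"

definition weight :: "(real ^ 'd \<Rightarrow> real) \<Rightarrow> bool" where
  "weight w \<longleftrightarrow> (\<forall>x. 0 \<le> w x) \<and> (\<forall>K. compact K \<longrightarrow> set_integrable lebesgue K w)"

definition weight_measure :: "(real ^ 'd \<Rightarrow> real) \<Rightarrow> (real ^ 'd) measure" where
  "weight_measure w = density lebesgue (\<lambda>x. ennreal (w x))"

definition mass :: "(real ^ 'd \<Rightarrow> real) \<Rightarrow> (real ^ 'd) set \<Rightarrow> ennreal" where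
  "mass w E = (\<integral>\<^sup>+x\<in>E. ennreal (w x) \<partial>lebesgue)"

definition average :: "(real ^ 'd \<Rightarrow> real) \<Rightarrow> (real ^ 'd) set \<Rightarrow> ennreal" where
  "average w Q = mass w Q / emeasure lebesgue Q"

text \<open>
  The norm of \<open>L\<^sup>q(w)\<close>, taken of the absolute value of a function; \<open>\<M>\<close> below takes values
  in \<open>[0, \<infinity>]\<close>.
\<close>

definition Lnorm :: "real \<Rightarrow> (real ^ 'd \<Rightarrow> real) \<Rightarrow> (real ^ 'd \<Rightarrow> ennreal) \<Rightarrow> ennreal" where
  "Lnorm q w g = (\<integral>\<^sup>+x. g x epowr q \<partial>weight_measure w) epowr (1 / q)"

definition Lspace :: "real \<Rightarrow> (real ^ 'd \<Rightarrow> real) \<Rightarrow> (real ^ 'd \<Rightarrow> real) set" where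
  "Lspace q w =
     {f \<in> borel_measurable (weight_measure w). Lnorm q w (\<lambda>x. ennreal \<bar>f x\<bar>) < \<infinity>}"

definition multilinear_maximal ::
    "('m::finite \<Rightarrow> real ^ 'd \<Rightarrow> real) \<Rightarrow> real ^ 'd \<Rightarrow> ennreal" ("\<M>") where
  "\<M> f x = (SUP Q\<in>{Q \<in> cubes. x \<in> Q}. \<Prod>i\<in>UNIV. average (\<lambda>y. \<bar>f i y\<bar>) Q)"

definition conjugate_exponent :: "real \<Rightarrow> real" where
  "conjugate_exponent q = q / (q - 1)"

text \<open>
  In the following, \<open>ps\<close> is the vector of the exponents \<open>p\<^sub>i\<close>, and \<open>p\<close> is meant to satisfy
  \<open>1 / p = (\<Sum>i\<in>UNIV. 1 / ps i)\<close>.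
\<close>

definition A_const ::
    "real \<Rightarrow> ('m::finite \<Rightarrow> real) \<Rightarrow> (real ^ 'd \<Rightarrow> real) \<Rightarrow> ('m \<Rightarrow> real ^ 'd \<Rightarrow> real) \<Rightarrow> ennreal" where
  "A_const p ps \<omega> \<sigma> =
     (SUP Q\<in>cubes. average \<omega> Q *
        (\<Prod>i\<in>UNIV. average (\<sigma> i) Q epowr (p / conjugate_exponent (ps i))))"

definition RH_bound ::
    "real \<Rightarrow> ('m::finite \<Rightarrow> real) \<Rightarrow> ('m \<Rightarrow> real ^ 'd \<Rightarrow> real) \<Rightarrow> ennreal \<Rightarrow> bool" where
  "RH_bound p ps \<sigma> C \<longleftrightarrow>
     (\<forall>Q\<in>cubes. (\<Prod>i\<in>UNIV. mass (\<sigma> i) Q epowr (p / ps i))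
        \<le> C * mass (\<lambda>x. \<Prod>i\<in>UNIV. \<sigma> i x powr (p / ps i)) Q)"

definition RH ::
    "real \<Rightarrow> ('m::finite \<Rightarrow> real) \<Rightarrow> ('m \<Rightarrow> real ^ 'd \<Rightarrow> real) \<Rightarrow> bool" where
  "RH p ps \<sigma> \<longleftrightarrow> (\<exists>C<\<infinity>. RH_bound p ps \<sigma> C)"

definition RH_const ::
    "real \<Rightarrow> ('m::finite \<Rightarrow> real) \<Rightarrow> ('m \<Rightarrow> real ^ 'd \<Rightarrow> real) \<Rightarrow> ennreal" where
  "RH_const p ps \<sigma> = Inf {C. RH_bound p ps \<sigma> C}"

definition parent_doubling_cubes ::
    "('m::finite \<Rightarrow> real ^ 'd \<Rightarrow> real) \<Rightarrow> real \<Rightarrow> real \<Rightarrow> (real ^ 'd) set set" where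
  "parent_doubling_cubes \<sigma> \<rho> D =
     {Q \<in> cubes. \<exists>P\<in>cubes. \<exists>i. Q \<subseteq> P \<and> side_length P \<ge> \<rho> * side_length Q \<and>
        mass (\<sigma> i) P \<le> ennreal D * mass (\<sigma> i) Q}"

definition parent_testing_const ::
    "real \<Rightarrow> ('m::finite \<Rightarrow> real) \<Rightarrow> real \<Rightarrow> real \<Rightarrow>
      (real ^ 'd \<Rightarrow> real) \<Rightarrow> ('m \<Rightarrow> real ^ 'd \<Rightarrow> real) \<Rightarrow> ennreal" where
  "parent_testing_const p ps \<rho> D \<omega> \<sigma> =
     Inf {C. \<forall>Q\<in>parent_doubling_cubes \<sigma> \<rho> D.
        (\<integral>\<^sup>+x\<in>Q. \<M> (\<lambda>i y. \<sigma> i y * indicator Q y) x epowr p * ennreal (\<omega> x) \<partial>lebesgue)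
          \<le> C * (\<Prod>i\<in>UNIV. mass (\<sigma> i) Q epowr (p / ps i))}"

definition N_const ::
    "real \<Rightarrow> ('m::finite \<Rightarrow> real) \<Rightarrow> (real ^ 'd \<Rightarrow> real) \<Rightarrow> ('m \<Rightarrow> real ^ 'd \<Rightarrow> real) \<Rightarrow> ennreal" where
  "N_const p ps \<omega> \<sigma> =
     Inf {C. \<forall>f. (\<forall>i. f i \<in> Lspace (ps i) (\<sigma> i)) \<longrightarrow>
        Lnorm p \<omega> (\<M> (\<lambda>i y. f i y * \<sigma> i y)) epowr p
          \<le> C * (\<Prod>i\<in>UNIV. Lnorm (ps i) (\<sigma> i) (\<lambda>x. ennreal \<bar>f i x\<bar>) epowr p)}"

end

theory Submission
  imports Defs
begin

text \<open>
  Testing on indicators gives the first inequality. For the second one, \<open>\<M>\<close> is dominated by the maximal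
  operators of \<open>2 ^ d\<close> shifted \<open>N\<close>-adic grids with \<open>N \<ge> \<rho>\<close>, and each of these is linearized: over a finite
  family of cells \<open>Q\<close>, the supremum is attained on disjoint sets \<open>E Q \<subseteq> Q\<close>. Put
  \<open>\<mu> Q = \<omega> (E Q) * (\<Prod>i. \<sigma>\<^sub>i Q / \<bar>Q\<bar>) ^ p\<close> and \<open>s Q = (\<Prod>i. \<sigma>\<^sub>i Q ^ (p / p\<^sub>i))\<close>. The packing estimate
  \<open>(\<Sum>Q \<subseteq> R. \<mu> Q) \<le> 2 * (A + P) * s R\<close> follows by induction on the depth of the family below \<open>R\<close>: the cell \<open>R\<close>
  itself contributes at most \<open>A * s R\<close>, the parent doubling children of \<open>R\<close> contribute at most
  \<open>P * s R\<close> by testing and Hoelder's inequality, and for \<open>D = 2 * N ^ d\<close> the at most \<open>N ^ d\<close> other children \<open>Q\<close> satisfy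
  \<open>s Q \<le> s R / D\<close>, so that they contribute at most half of the claimed bound. The reverse Hoelder condition
  replaces \<open>s R\<close> by the measure of \<open>R\<close> with density \<open>\<Prod>i. \<sigma>\<^sub>i ^ (p / p\<^sub>i)\<close>, and the Carleson embedding theorem,
  Hoelder's inequality and the maximal inequalities with respect to the \<open>\<sigma>\<^sub>i\<close> finish the proof.
\<close>

section \<open>Powers in the extended half-line\<close>

lemma epowr_simps [simp]:
  "0 epowr r = 0" "\<infinity> epowr r = \<infinity>" "top epowr r = top" "1 epowr r = 1"
  by (simp_all add: ennreal_powr_def)

lemma ennreal_epowr: "0 \<le> x \<Longrightarrow> ennreal x epowr r = ennreal (x powr r)"
  by (simp add: ennreal_powr_def)

lemma epowr_1 [simp]: "x epowr 1 = x"
  by (cases x) (simp_all add: ennreal_powr_def)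

lemma epowr_mono: "x \<le> y \<Longrightarrow> 0 \<le> r \<Longrightarrow> x epowr r \<le> y epowr r"
  by (cases x; cases y) (auto simp: ennreal_powr_def ennreal_leI powr_mono2 top_unique)

lemma epowr_eq_0_iff [simp]: "x epowr r = 0 \<longleftrightarrow> x = 0"
  by (cases x) (auto simp: ennreal_powr_def)

lemma epowr_eq_top_iff [simp]: "x epowr r = top \<longleftrightarrow> x = top"
  by (cases x) (auto simp: ennreal_powr_def)

lemma epowr_less_top_iff [simp]: "x epowr r < top \<longleftrightarrow> x < top"
  by (simp add: less_top[symmetric])

text \<open>A zero factor makes both sides zero, in agreement with
  \<open>0 * \<infinity> = 0\<close>; otherwise an infinite factor makes both sides
  infinite.\<close>

lemma epowr_mult: "(x * y) epowr r = x epowr r * y epowr r"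
proof (cases x)
  case (real a)
  show ?thesis
  proof (cases y)
    case (real b)
    with \<open>x = ennreal a\<close> \<open>0 \<le> a\<close> show ?thesis
      by (simp add: ennreal_epowr powr_mult flip: ennreal_mult)
  qed (cases "a = 0"; use real in \<open>auto simp: ennreal_mult_top ennreal_epowr\<close>)
qed (cases "y = 0"; auto simp: ennreal_top_mult)

lemma epowr_prod: "(\<Prod>i\<in>A. f i) epowr r = (\<Prod>i\<in>A. f i epowr r)"
  by (induction A rule: infinite_finite_induct) (simp_all add: epowr_mult)

lemma epowr_add: "0 < r \<Longrightarrow> 0 < s \<Longrightarrow> x epowr (r + s) = x epowr r * x epowr s"
  by (cases x) (auto simp: ennreal_epowr powr_add ennreal_mult)

lemma epowr_sum:
  assumes "finite A" "A \<noteq> {}" "\<And>i. i \<in> A \<Longrightarrow> 0 < r i"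
  shows "x epowr (\<Sum>i\<in>A. r i) = (\<Prod>i\<in>A. x epowr r i)"
  using assms by (induction A rule: finite_ne_induct) (auto simp: epowr_add sum_pos)

lemma epowr_epowr: "(x epowr r) epowr s = x epowr (r * s)"
  by (cases x) (auto simp: ennreal_epowr powr_powr)

lemma epowr_inverse: "0 < r \<Longrightarrow> (x epowr r) epowr (1 / r) = x" "0 < r \<Longrightarrow> (x epowr (1 / r)) epowr r = x"
  by (simp_all add: epowr_epowr)

lemma epowr_SUP:
  assumes "0 < r" shows "(SUP i\<in>A. f i) epowr r = (SUP i\<in>A. f i epowr r)"
proof (rule antisym)
  \<comment> \<open>The power \<open>1 / r\<close> is a monotone inverse, which moves the exponent
    to the other side of the inequality.\<close>
  have "f i \<le> (SUP i\<in>A. (f i) epowr r) epowr (1 / r)" if "i \<in> A" for i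
    using epowr_mono[OF SUP_upper[OF that, of "\<lambda>i. f i epowr r"], of "1 / r"] assms
    by (simp add: epowr_inverse)
  then have "(SUP i\<in>A. f i) \<le> (SUP i\<in>A. (f i) epowr r) epowr (1 / r)"
    by (rule SUP_least)
  from epowr_mono[OF this, of r] assms
  show "(SUP i\<in>A. f i) epowr r \<le> (SUP i\<in>A. f i epowr r)"
    by (simp add: epowr_inverse)
  show "(SUP i\<in>A. f i epowr r) \<le> (SUP i\<in>A. f i) epowr r"
    using assms by (intro SUP_least epowr_mono SUP_upper) auto
qed

lemma borel_measurable_epowr [measurable (raw)]:
  assumes [measurable]: "f \<in> borel_measurable M"
  shows "(\<lambda>x. f x epowr r) \<in> borel_measurable M"
  unfolding ennreal_powr_def by measurable

lemma epowr_indicator: "(a * indicator A x :: ennreal) epowr r = a epowr r * indicator A x"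
  by (simp add: indicator_def)

section \<open>Hoelder's inequality for several functions\<close>

text \<open>Concavity of the logarithm, in the form of the tangent line bound
  \<open>ln t \<le> t - 1\<close>.\<close>

lemma weighted_AM_GM:
  fixes x \<theta> :: "'i \<Rightarrow> real"
  assumes "finite A" "\<And>i. i \<in> A \<Longrightarrow> 0 \<le> x i" "\<And>i. i \<in> A \<Longrightarrow> 0 < \<theta> i" "(\<Sum>i\<in>A. \<theta> i) = 1"
  shows "(\<Prod>i\<in>A. x i powr \<theta> i) \<le> (\<Sum>i\<in>A. \<theta> i * x i)"
proof (cases "\<exists>i\<in>A. x i = 0")
  case True
  then have "(\<Prod>i\<in>A. x i powr \<theta> i) = 0"
    using \<open>finite A\<close> by (auto simp: prod_zero_iff)
  moreover have "0 \<le> (\<Sum>i\<in>A. \<theta> i * x i)"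
    using assms by (intro sum_nonneg) (auto simp: less_imp_le)
  ultimately show ?thesis by simp
next
  case False
  with assms have x: "0 < x i" if "i \<in> A" for i
    using that by (simp add: order_less_le)
  \<comment> \<open>Dividing by the weighted mean makes the tangent line terms cancel after
    summation.\<close>
  define S where "S = (\<Sum>i\<in>A. \<theta> i * x i)"
  have "A \<noteq> {}" using assms by auto
  then have S: "0 < S"
    unfolding S_def using assms x by (intro sum_pos) auto
  have "(\<Sum>i\<in>A. \<theta> i * ln (x i / S)) \<le> (\<Sum>i\<in>A. \<theta> i * (x i / S - 1))"
    using assms x S by (intro sum_mono mult_left_mono ln_le_minus_one) (auto simp: less_imp_le)
  also have "\<dots> = (\<Sum>i\<in>A. \<theta> i * x i) / S - (\<Sum>i\<in>A. \<theta> i)"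
    by (simp add: right_diff_distrib sum_subtractf sum_divide_distrib)
  also have "\<dots> = 0"
    using S assms by (simp flip: S_def)
  finally have *: "(\<Sum>i\<in>A. \<theta> i * ln (x i / S)) \<le> 0" .
  have "(\<Sum>i\<in>A. \<theta> i * ln (x i)) \<le> (\<Sum>i\<in>A. \<theta> i * ln S)"
  proof -
    have "(\<Sum>i\<in>A. \<theta> i * ln (x i / S)) = (\<Sum>i\<in>A. \<theta> i * ln (x i) - \<theta> i * ln S)"
      using S by (intro sum.cong refl) (auto simp: ln_div right_diff_distrib dest!: x)
    with * show ?thesis
      by (simp add: sum_subtractf)
  qed
  also have "\<dots> = ln S"
    using assms by (simp flip: sum_distrib_right)
  finally have "exp (\<Sum>i\<in>A. \<theta> i * ln (x i)) \<le> S"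
    using S by (metis exp_le_cancel_iff exp_ln)
  moreover have "exp (\<Sum>i\<in>A. \<theta> i * ln (x i)) = (\<Prod>i\<in>A. x i powr \<theta> i)"
    unfolding exp_sum[OF \<open>finite A\<close>] by (intro prod.cong) (auto simp: powr_def dest!: x)
  ultimately show ?thesis
    by (simp add: S_def)
qed

text \<open>An infinite \<open>x i\<close> makes the right-hand side infinite because its weight is
  positive; otherwise the real inequality applies.\<close>

lemma weighted_AM_GM_ennreal:
  fixes x :: "'i \<Rightarrow> ennreal"
  assumes "finite A" "\<And>i. i \<in> A \<Longrightarrow> 0 < \<theta> i" "(\<Sum>i\<in>A. \<theta> i) = 1"
  shows "(\<Prod>i\<in>A. x i epowr \<theta> i) \<le> (\<Sum>i\<in>A. ennreal (\<theta> i) * x i)"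
proof (cases "\<exists>i\<in>A. x i = top")
  case True
  then obtain i where "i \<in> A" "x i = top" by auto
  then have "(\<Sum>i\<in>A. ennreal (\<theta> i) * x i) = top"
    using assms by (force simp: ennreal_mult_eq_top_iff)
  then show ?thesis by simp
next
  case False
  then have x: "x i = ennreal (enn2real (x i))" if "i \<in> A" for i
    using that by (simp add: less_top)
  have "(\<Prod>i\<in>A. x i epowr \<theta> i) = (\<Prod>i\<in>A. ennreal (enn2real (x i) powr \<theta> i))"
    using False by (intro prod.cong) (auto simp: ennreal_powr_def)
  also have "\<dots> = ennreal (\<Prod>i\<in>A. enn2real (x i) powr \<theta> i)"
    by (simp add: prod_ennreal)
  also have "\<dots> \<le> ennreal (\<Sum>i\<in>A. \<theta> i * enn2real (x i))"
    using assms by (intro ennreal_leI weighted_AM_GM) auto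
  also have "\<dots> = (\<Sum>i\<in>A. ennreal (\<theta> i * enn2real (x i)))"
    using assms by (intro sum_ennreal[symmetric]) (auto simp: less_imp_le)
  also have "\<dots> = (\<Sum>i\<in>A. ennreal (\<theta> i) * x i)"
    using assms x by (intro sum.cong) (auto simp: ennreal_mult less_imp_le)
  finally show ?thesis .
qed

text \<open>The weighted AM-GM inequality is applied pointwise to the functions divided by their
  integrals \<open>G i\<close>, and then integrated.\<close>

lemma Holder_prod:
  fixes g :: "'i \<Rightarrow> 'a \<Rightarrow> ennreal"
  assumes "finite A" "\<And>i. i \<in> A \<Longrightarrow> 0 < \<theta> i" "(\<Sum>i\<in>A. \<theta> i) = 1"
    and [measurable]: "\<And>i. i \<in> A \<Longrightarrow> g i \<in> borel_measurable M"
  shows "(\<integral>\<^sup>+x. (\<Prod>i\<in>A. g i x epowr \<theta> i) \<partial>M) \<le> (\<Prod>i\<in>A. (\<integral>\<^sup>+x. g i x \<partial>M) epowr \<theta> i)"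
proof -
  define G where "G i = (\<integral>\<^sup>+x. g i x \<partial>M)" for i
  \<comment> \<open>A vanishing \<open>G i\<close> is treated first: it makes the right-hand side 0
    even if another integral is infinite, and then the integrand vanishes almost everywhere.\<close>
  consider (zero) i where "i \<in> A" "G i = 0" | (top) i where "\<forall>i\<in>A. G i \<noteq> 0" "i \<in> A" "G i = top"
    | (fin) "\<forall>i\<in>A. G i \<noteq> 0" "\<forall>i\<in>A. G i \<noteq> top" by blast
  then show ?thesis
  proof cases
    case zero
    then have "AE x in M. g i x = 0"
      by (simp add: G_def nn_integral_0_iff_AE)
    then have "AE x in M. (\<Prod>i\<in>A. g i x epowr \<theta> i) = 0"
      by eventually_elim (use \<open>finite A\<close> \<open>i \<in> A\<close> in \<open>auto simp: prod_zero_iff\<close>)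
    then have "(\<integral>\<^sup>+x. (\<Prod>i\<in>A. g i x epowr \<theta> i) \<partial>M) = (\<integral>\<^sup>+x. 0 \<partial>M)"
      by (intro nn_integral_cong_AE)
    then show ?thesis by simp
  next
    case top
    then have "(\<Prod>i\<in>A. G i epowr \<theta> i) = top"
      using \<open>finite A\<close> by (auto simp: ennreal_prod_eq_top)
    then show ?thesis by (simp add: G_def)
  next
    case fin
    have *: "(\<Prod>i\<in>A. g i x epowr \<theta> i) \<le> (\<Prod>i\<in>A. G i epowr \<theta> i) * (\<Sum>i\<in>A. ennreal (\<theta> i) * (g i x / G i))" for x
    proof -
      have "g i x = G i * (g i x / G i)" if "i \<in> A" for i
        using fin that by (simp add: ennreal_times_divide mult.commute[of "G i"] mult_divide_eq_ennreal)
      then have "(\<Prod>i\<in>A. g i x epowr \<theta> i) = (\<Prod>i\<in>A. G i epowr \<theta> i * (g i x / G i) epowr \<theta> i)"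
        by (intro prod.cong refl) (metis epowr_mult)
      also have "\<dots> = (\<Prod>i\<in>A. G i epowr \<theta> i) * (\<Prod>i\<in>A. (g i x / G i) epowr \<theta> i)"
        by (rule prod.distrib)
      also have "\<dots> \<le> (\<Prod>i\<in>A. G i epowr \<theta> i) * (\<Sum>i\<in>A. ennreal (\<theta> i) * (g i x / G i))"
        by (intro mult_left_mono weighted_AM_GM_ennreal assms) auto
      finally show ?thesis .
    qed
    have "(\<integral>\<^sup>+x. (\<Prod>i\<in>A. g i x epowr \<theta> i) \<partial>M)
        \<le> (\<integral>\<^sup>+x. (\<Prod>i\<in>A. G i epowr \<theta> i) * (\<Sum>i\<in>A. ennreal (\<theta> i) * (g i x / G i)) \<partial>M)"
      by (intro nn_integral_mono *)
    also have "\<dots> = (\<Prod>i\<in>A. G i epowr \<theta> i) * (\<Sum>i\<in>A. ennreal (\<theta> i) * (G i / G i))"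
      unfolding G_def divide_ennreal_def
      by (subst nn_integral_cmult, measurable, subst nn_integral_sum, measurable)
         (simp add: nn_integral_cmult nn_integral_multc)
    also have "(\<Sum>i\<in>A. ennreal (\<theta> i) * (G i / G i)) = (\<Sum>i\<in>A. ennreal (\<theta> i))"
      using fin by (intro sum.cong) (auto simp: less_top)
    also have "\<dots> = 1"
      using assms by (subst sum_ennreal) (auto simp: less_imp_le)
    finally show ?thesis by (simp add: G_def)
  qed
qed

lemma Holder_sum:
  fixes g :: "'i \<Rightarrow> 'a \<Rightarrow> ennreal"
  assumes "finite A" "\<And>i. i \<in> A \<Longrightarrow> 0 < \<theta> i" "(\<Sum>i\<in>A. \<theta> i) = 1" "finite B"
  shows "(\<Sum>x\<in>B. (\<Prod>i\<in>A. g i x epowr \<theta> i)) \<le> (\<Prod>i\<in>A. (\<Sum>x\<in>B. g i x) epowr \<theta> i)"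
  using Holder_prod[OF assms(1-3), of g "count_space B"] \<open>finite B\<close>
  by (simp add: nn_integral_count_space_finite)

section \<open>Layer cake\<close>

lemma nn_integral_powr_Ioo:
  fixes c :: real
  assumes "0 < r" "0 \<le> c"
  shows "(\<integral>\<^sup>+l. ennreal (r * l powr (r - 1)) * indicator {0<..<c} l \<partial>lborel) = ennreal (c powr r)"
proof -
  have "((\<lambda>l. r * l powr (r - 1)) has_integral r * (c powr (r - 1 + 1) / (r - 1 + 1))) {0..c}"
    using assms by (intro has_integral_mult_right has_integral_powr_from_0) auto
  then have "((\<lambda>l. r * l powr (r - 1)) has_integral c powr r) {0..c}"
    using assms by simp
  from nn_integral_has_integral_lebesgue'[OF _ this] assms
  have "(\<integral>\<^sup>+l. ennreal (r * l powr (r - 1)) * indicator {0..c} l \<partial>lborel) = ennreal (c powr r)"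
    by simp
  moreover have "(\<integral>\<^sup>+l. ennreal (r * l powr (r - 1)) * indicator {0<..<c} l \<partial>lborel) =
      (\<integral>\<^sup>+l. ennreal (r * l powr (r - 1)) * indicator {0..c} l \<partial>lborel)"
  proof (rule nn_integral_cong_AE)
    have "AE l in lborel. l \<noteq> 0" "AE l in lborel. l \<noteq> c"
      by (auto intro: AE_lborel_singleton)
    then show "AE l in lborel. ennreal (r * l powr (r - 1)) * indicator {0<..<c} l =
        ennreal (r * l powr (r - 1)) * indicator {0..c} l"
      by eventually_elim (auto simp: indicator_def)
  qed
  ultimately show ?thesis by simp
qed

lemma layer_cake:
  fixes c :: ennreal
  assumes "0 < r"
  shows "(\<integral>\<^sup>+l. ennreal (r * l powr (r - 1)) * indicator {l. 0 < l \<and> ennreal l < c} l \<partial>lborel) = c epowr r"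
proof (cases c)
  case (real y)
  then have "{l. 0 < l \<and> ennreal l < c} = {0<..<y}"
    by (auto simp: ennreal_less_iff)
  with real assms nn_integral_powr_Ioo[of r y] show ?thesis
    by (simp add: ennreal_epowr)
next
  case top
  \<comment> \<open>At infinite height the integral dominates those up to any finite height, and the
    height \<open>real n powr (1 / r)\<close> gives the value \<open>n\<close>.\<close>
  have *: "ennreal (real n) \<le> (\<integral>\<^sup>+l. ennreal (r * l powr (r - 1)) * indicator {l. 0 < l \<and> ennreal l < c} l \<partial>lborel)" for n
  proof -
    have "(real n powr (1 / r)) powr r = real n"
      using assms by (simp add: powr_powr)
    then have "ennreal (real n) = ennreal ((real n powr (1 / r)) powr r)"
      by (simp only:)
    also have "\<dots> = (\<integral>\<^sup>+l. ennreal (r * l powr (r - 1)) * indicator {0<..<real n powr (1 / r)} l \<partial>lborel)"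
      using assms by (intro nn_integral_powr_Ioo[symmetric]) auto
    also have "\<dots> \<le> (\<integral>\<^sup>+l. ennreal (r * l powr (r - 1)) * indicator {l. 0 < l \<and> ennreal l < c} l \<partial>lborel)"
      by (intro nn_integral_mono) (auto simp: indicator_def top)
    finally show ?thesis .
  qed
  have "(\<integral>\<^sup>+l. ennreal (r * l powr (r - 1)) * indicator {l. 0 < l \<and> ennreal l < c} l \<partial>lborel) = top" (is "?I = top")
  proof (cases ?I)
    case (real y)
    obtain n where "y < real n" using reals_Archimedean2 by blast
    with *[of n] real show ?thesis by simp
  qed
  with top show ?thesis by simp
qed

text \<open>The factor \<open>1\<close> is the instance \<open>g = 1\<close> of the integrand in
  \<open>nn_integral_layer_cake\<close>, whose inner integral thus becomes the measure of a level
  set.\<close>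

lemma nn_integral_level_set:
  assumes [measurable]: "S \<in> borel_measurable M"
  shows "(\<integral>\<^sup>+x. 1 * indicator {x. l < S x} x \<partial>M) = emeasure M {x \<in> space M. l < (S x :: ennreal)}"
proof -
  have "(\<integral>\<^sup>+x. 1 * indicator {x. l < S x} x \<partial>M) = (\<integral>\<^sup>+x. indicator {x \<in> space M. l < S x} x \<partial>M)"
    by (intro nn_integral_cong) (auto simp: indicator_def)
  then show ?thesis
    by (subst (asm) nn_integral_indicator) measurable
qed

text \<open>Tonelli's theorem applied to \<open>layer_cake\<close>. The factor \<open>g\<close>
  serves the maximal inequality, where a function is integrated over its own level sets.\<close>

lemma nn_integral_layer_cake:
  assumes "sigma_finite_measure M" "0 < r"
    and [measurable]: "g \<in> borel_measurable M" "S \<in> borel_measurable M"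
  shows "(\<integral>\<^sup>+x. g x * S x epowr r \<partial>M) =
    (\<integral>\<^sup>+l. ennreal (r * l powr (r - 1)) * indicator {0<..} l *
      (\<integral>\<^sup>+x. g x * indicator {x. ennreal l < S x} x \<partial>M) \<partial>lborel)"
proof -
  interpret M: sigma_finite_measure M by fact
  interpret pair_sigma_finite M lborel ..
  define w where "w l = ennreal (r * l powr (r - 1)) * indicator {0<..} l" for l
  have [measurable]: "w \<in> borel_measurable borel"
    unfolding w_def by measurable
  have "(\<integral>\<^sup>+x. g x * S x epowr r \<partial>M) =
      (\<integral>\<^sup>+x. (\<integral>\<^sup>+l. g x * (w l * indicator {x. ennreal l < S x} x) \<partial>lborel) \<partial>M)"
  proof (intro nn_integral_cong)
    fix x
    have "(\<integral>\<^sup>+l. w l * indicator {x. ennreal l < S x} x \<partial>lborel) = S x epowr r"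
      unfolding layer_cake[OF \<open>0 < r\<close>, symmetric]
      by (intro nn_integral_cong) (auto simp: w_def indicator_def)
    moreover have "(\<lambda>l. w l * indicator {x. ennreal l < S x} x) \<in> borel_measurable lborel"
      by measurable
    ultimately show "g x * S x epowr r = (\<integral>\<^sup>+l. g x * (w l * indicator {x. ennreal l < S x} x) \<partial>lborel)"
      by (simp add: nn_integral_cmult)
  qed
  also have "\<dots> = (\<integral>\<^sup>+l. (\<integral>\<^sup>+x. g x * (w l * indicator {x. ennreal l < S x} x) \<partial>M) \<partial>lborel)"
    by (intro Fubini'[symmetric]) measurable
  also have "\<dots> = (\<integral>\<^sup>+l. w l * (\<integral>\<^sup>+x. g x * indicator {x. ennreal l < S x} x \<partial>M) \<partial>lborel)"
    by (intro nn_integral_cong, subst nn_integral_cmult[symmetric], measurable)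
       (simp add: ac_simps)
  finally show ?thesis
    by (simp add: w_def)
qed

section \<open>Finite laminar families of sets\<close>

text \<open>The property of grid cells on which the covering arguments below rest.\<close>

definition laminar :: "('i \<Rightarrow> 'a set) \<Rightarrow> 'i set \<Rightarrow> bool" where
  "laminar Q F \<longleftrightarrow> (\<forall>q\<in>F. \<forall>r\<in>F. Q q \<subseteq> Q r \<or> Q r \<subseteq> Q q \<or> Q q \<inter> Q r = {})"

lemma laminar_mono: "laminar Q F \<Longrightarrow> F' \<subseteq> F \<Longrightarrow> laminar Q F'"
  by (meson laminar_def subsetD)

text \<open>The cover consists of maximal members. Inserting one member at a time also takes care of
  equal sets with different indices.\<close>

lemma laminar_disjoint_cover:
  assumes "finite F" "laminar Q F"
  obtains G where "G \<subseteq> F" "disjoint_family_on Q G" "\<And>q. q \<in> F \<Longrightarrow> \<exists>g\<in>G. Q q \<subseteq> Q g"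
proof -
  have "\<exists>G\<subseteq>F. disjoint_family_on Q G \<and> (\<forall>q\<in>F. \<exists>g\<in>G. Q q \<subseteq> Q g)"
    using assms
  proof (induction F rule: finite_induct)
    case empty
    then show ?case by (auto simp: disjoint_family_on_def)
  next
    case (insert q F)
    then obtain G where G: "G \<subseteq> F" "disjoint_family_on Q G" "\<forall>q\<in>F. \<exists>g\<in>G. Q q \<subseteq> Q g"
      by (meson laminar_mono subset_insertI)
    show ?case
    proof (cases "\<exists>g\<in>G. Q q \<subseteq> Q g")
      case True
      with G show ?thesis by (intro exI[of _ G]) auto
    next
      case False
      \<comment> \<open>The new member replaces those it contains; by laminarity it is disjoint from
        the others, because none of them contains it.\<close>
      define G' where "G' = insert q {g\<in>G. \<not> Q g \<subseteq> Q q}"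
      have "Q q \<inter> Q g = {}" if "g \<in> G" "\<not> Q g \<subseteq> Q q" for g
        using that G False insert.prems unfolding laminar_def by blast
      then have "disjoint_family_on Q G'"
        using G(2) unfolding G'_def disjoint_family_on_def by auto
      moreover have "\<exists>g\<in>G'. Q r \<subseteq> Q g" if "r \<in> insert q F" for r
        using that G(3) unfolding G'_def by (metis (no_types, lifting) insert_iff mem_Collect_eq order_refl order_trans)
      ultimately show ?thesis
        using G(1) by (intro exI[of _ G']) (auto simp: G'_def)
    qed
  qed
  then show ?thesis using that by blast
qed

text \<open>Both measures are additive over the disjoint maximal members, so a bound for single
  members passes to the union. This is the covering step of the weak type estimate.\<close>

lemma emeasure_laminar_Union_le:
  assumes F: "finite F" "laminar Q F" and sets: "\<And>q. q \<in> F \<Longrightarrow> Q q \<in> sets M"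
    and bound: "\<And>q. q \<in> F \<Longrightarrow> a * emeasure M (Q q) \<le> b * emeasure N (Q q)"
    and N: "sets N = sets M"
  shows "a * emeasure M (\<Union>q\<in>F. Q q) \<le> b * emeasure N (\<Union>q\<in>F. Q q)"
proof -
  obtain G where G: "G \<subseteq> F" "disjoint_family_on Q G" "\<And>q. q \<in> F \<Longrightarrow> \<exists>g\<in>G. Q q \<subseteq> Q g"
    using laminar_disjoint_cover[OF F] by blast
  then have Un: "(\<Union>q\<in>F. Q q) = (\<Union>q\<in>G. Q q)"
    by blast
  have "finite G" using G(1) F(1) finite_subset by blast
  have "a * emeasure M (\<Union>q\<in>G. Q q) = (\<Sum>g\<in>G. a * emeasure M (Q g))"
    using G sets \<open>finite G\<close> by (subst sum_emeasure[symmetric]) (auto simp: sum_distrib_left)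
  also have "\<dots> \<le> (\<Sum>g\<in>G. b * emeasure N (Q g))"
    using G by (intro sum_mono bound) auto
  also have "\<dots> = b * emeasure N (\<Union>q\<in>G. Q q)"
    using G sets \<open>finite G\<close> by (subst sum_emeasure[symmetric]) (auto simp: sum_distrib_left N)
  finally show ?thesis by (simp add: Un)
qed

lemma sum_UNION_le:
  fixes \<mu> :: "'i \<Rightarrow> ennreal"
  assumes "finite G" "\<And>g. g \<in> G \<Longrightarrow> finite (B g)"
  shows "sum \<mu> (\<Union>g\<in>G. B g) \<le> (\<Sum>g\<in>G. sum \<mu> (B g))"
  using assms
proof (induction G rule: finite_induct)
  case (insert g G)
  then have "sum \<mu> (B g \<union> (\<Union>g\<in>G. B g)) \<le> sum \<mu> (B g) + sum \<mu> (\<Union>g\<in>G. B g)"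
    by (subst sum.union_inter[symmetric]) auto
  also have "\<dots> \<le> sum \<mu> (B g) + (\<Sum>g\<in>G. sum \<mu> (B g))"
    using insert by (intro add_left_mono) auto
  finally show ?case using insert by simp
qed simp

text \<open>Every member lies below a maximal one, and the packing bounds of the disjoint maximal
  members add up to the measure of the union.\<close>

lemma sum_laminar_le:
  fixes \<mu> :: "'i \<Rightarrow> ennreal"
  assumes F: "finite F" "laminar Q F" and sets: "\<And>q. q \<in> F \<Longrightarrow> Q q \<in> sets M"
    and packing: "\<And>r. r \<in> F \<Longrightarrow> (\<Sum>q\<in>{q\<in>F. Q q \<subseteq> Q r}. \<mu> q) \<le> K * emeasure M (Q r)"
  shows "(\<Sum>q\<in>F. \<mu> q) \<le> K * emeasure M (\<Union>q\<in>F. Q q)"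
proof -
  obtain G where G: "G \<subseteq> F" "disjoint_family_on Q G" "\<And>q. q \<in> F \<Longrightarrow> \<exists>g\<in>G. Q q \<subseteq> Q g"
    using laminar_disjoint_cover[OF F] by blast
  then have Un: "(\<Union>q\<in>F. Q q) = (\<Union>q\<in>G. Q q)"
    by blast
  have "finite G" using G(1) F(1) finite_subset by blast
  have "(\<Sum>q\<in>F. \<mu> q) \<le> (\<Sum>q\<in>(\<Union>g\<in>G. {q\<in>F. Q q \<subseteq> Q g}). \<mu> q)"
    using G(3) F(1) \<open>finite G\<close> by (intro sum_mono2) auto
  also have "\<dots> \<le> (\<Sum>g\<in>G. \<Sum>q\<in>{q\<in>F. Q q \<subseteq> Q g}. \<mu> q)"
    using F(1) \<open>finite G\<close> by (intro sum_UNION_le) auto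
  also have "\<dots> \<le> (\<Sum>g\<in>G. K * emeasure M (Q g))"
    using G by (intro sum_mono packing) auto
  also have "\<dots> = K * emeasure M (\<Union>q\<in>G. Q q)"
    using G sets \<open>finite G\<close> by (subst sum_emeasure[symmetric]) (auto simp: sum_distrib_left)
  finally show ?thesis by (simp add: Un)
qed

section \<open>Carleson embedding, maximal inequality and linearization for finite families\<close>

lemma less_SUP_indicator_iff:
  fixes c :: "'i \<Rightarrow> ennreal"
  shows "l < (SUP q\<in>F. c q * indicator (Q q) x) \<longleftrightarrow> x \<in> (\<Union>q\<in>{q\<in>F. l < c q}. Q q)"
  by (auto simp: less_SUP_iff indicator_def split: if_splits)

text \<open>Both sides are split into heights by the layer cake formula. At each height the members
  with larger \<open>c\<close> form a laminar family to which \<open>sum_laminar_le\<close>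
  applies.\<close>

lemma Carleson_embedding:
  fixes \<mu> c :: "'i \<Rightarrow> ennreal"
  assumes "sigma_finite_measure M" and F: "finite F" "laminar Q F"
    and sets [measurable]: "\<And>q. q \<in> F \<Longrightarrow> Q q \<in> sets M"
    and packing: "\<And>r. r \<in> F \<Longrightarrow> (\<Sum>q\<in>{q\<in>F. Q q \<subseteq> Q r}. \<mu> q) \<le> K * emeasure M (Q r)"
  shows "(\<Sum>q\<in>F. \<mu> q * c q) \<le> K * (\<integral>\<^sup>+x. (SUP q\<in>F. c q * indicator (Q q) x) \<partial>M)"
proof -
  define S where "S x = (SUP q\<in>F. c q * indicator (Q q) x)" for x
  have Q_space: "Q q \<subseteq> space M" if "q \<in> F" for q
    using sets[OF that] by (rule sets.sets_into_space)
  have [measurable]: "S \<in> borel_measurable M"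
    unfolding S_def using F(1) by (intro borel_measurable_SUP) (auto simp: countable_finite)
  \<comment> \<open>The layer cake weight for \<open>r = 1\<close>, equal to 1 at positive heights,
    in the form in which \<open>layer_cake\<close> yields it.\<close>
  define w where "w l = (ennreal (1 * l powr (1 - 1)) * indicator {0<..} l :: ennreal)" for l :: real
  have [measurable]: "w \<in> borel_measurable borel"
    unfolding w_def by measurable
  have c: "c q = (\<integral>\<^sup>+l. w l * indicator {l. ennreal l < c q} l \<partial>lborel)" for q
    using layer_cake[of 1 "c q"]
    by (auto simp: w_def indicator_def intro!: nn_integral_cong elim!: trans[OF sym])
  have "(\<Sum>q\<in>F. \<mu> q * c q) = (\<integral>\<^sup>+l. (\<Sum>q\<in>F. \<mu> q * (w l * indicator {l. ennreal l < c q} l)) \<partial>lborel)"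
    by (subst nn_integral_sum, measurable, subst nn_integral_cmult, measurable) (simp flip: c)
  also have "\<dots> \<le> (\<integral>\<^sup>+l. K * (w l * (\<integral>\<^sup>+x. 1 * indicator {x. ennreal l < S x} x \<partial>M)) \<partial>lborel)"
  proof (intro nn_integral_mono)
    fix l :: real
    \<comment> \<open>Packing passes to this subfamily, since dropping members only decreases the
      left-hand side.\<close>
    define F' where "F' = {q\<in>F. ennreal l < c q}"
    have "(\<Sum>q\<in>{q\<in>F'. Q q \<subseteq> Q r}. \<mu> q) \<le> K * emeasure M (Q r)" if "r \<in> F'" for r
    proof -
      have "(\<Sum>q\<in>{q\<in>F'. Q q \<subseteq> Q r}. \<mu> q) \<le> (\<Sum>q\<in>{q\<in>F. Q q \<subseteq> Q r}. \<mu> q)"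
        using F(1) by (intro sum_mono2) (auto simp: F'_def)
      also have "\<dots> \<le> K * emeasure M (Q r)"
        using that by (intro packing) (auto simp: F'_def)
      finally show ?thesis .
    qed
    then have "(\<Sum>q\<in>F'. \<mu> q) \<le> K * emeasure M (\<Union>q\<in>F'. Q q)"
      using F laminar_mono[OF F(2), of F'] by (intro sum_laminar_le) (auto simp: F'_def sets)
    \<comment> \<open>The union of the members with \<open>c\<close> above the height is a level set
      of the supremum \<open>S\<close>.\<close>
    also have "emeasure M (\<Union>q\<in>F'. Q q) = (\<integral>\<^sup>+x. 1 * indicator {x. ennreal l < S x} x \<partial>M)"
    proof -
      have "(\<Union>q\<in>F'. Q q) = {x \<in> space M. ennreal l < S x}"
        unfolding S_def less_SUP_indicator_iff using Q_space by (auto simp: F'_def)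
      then show ?thesis
        by (simp only: nn_integral_level_set[OF \<open>S \<in> borel_measurable M\<close>])
    qed
    finally have "w l * (\<Sum>q\<in>F'. \<mu> q) \<le> w l * (K * (\<integral>\<^sup>+x. 1 * indicator {x. ennreal l < S x} x \<partial>M))"
      by (rule mult_left_mono) simp
    moreover have "(\<Sum>q\<in>F. \<mu> q * (w l * indicator {l. ennreal l < c q} l)) = w l * (\<Sum>q\<in>F'. \<mu> q)"
      using F(1) unfolding F'_def sum_distrib_left
      by (subst sum.inter_filter) (auto simp: indicator_def ac_simps intro!: sum.cong)
    ultimately show "(\<Sum>q\<in>F. \<mu> q * (w l * indicator {l. ennreal l < c q} l)) \<le>
        K * (w l * (\<integral>\<^sup>+x. 1 * indicator {x. ennreal l < S x} x \<partial>M))"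
      by (simp add: ac_simps)
  qed
  also have "\<dots> = K * (\<integral>\<^sup>+x. S x \<partial>M)"
  proof -
    interpret M: sigma_finite_measure M by fact
    have "(\<lambda>l. \<integral>\<^sup>+x. 1 * indicator {x. ennreal l < S x} x \<partial>M) \<in> borel_measurable lborel"
      by measurable
    then show ?thesis
      using nn_integral_layer_cake[OF assms(1), of 1 "\<lambda>_. 1" S]
      by (subst nn_integral_cmult) (auto simp: w_def)
  qed
  finally show ?thesis
    by (simp add: S_def)
qed

text \<open>
  The weak type estimate is applied to the part of \<open>f\<close> above half the height, so that the strong type
  estimate follows without knowing in advance that its left-hand side is finite.
\<close>

lemma laminar_maximal_inequality:
  fixes f :: "'a \<Rightarrow> ennreal"
  assumes "sigma_finite_measure M" and F: "finite F" "laminar Q F"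
    and sets [measurable]: "\<And>q. q \<in> F \<Longrightarrow> Q q \<in> sets M"
    and fin: "\<And>q. q \<in> F \<Longrightarrow> emeasure M (Q q) < \<infinity>"
    and [measurable]: "f \<in> borel_measurable M" and "1 < r"
  shows "(\<integral>\<^sup>+x. (SUP q\<in>F. (\<integral>\<^sup>+y\<in>Q q. f y \<partial>M) / emeasure M (Q q) * indicator (Q q) x) epowr r \<partial>M)
    \<le> ennreal (2 powr r * (r / (r - 1))) * (\<integral>\<^sup>+x. f x epowr r \<partial>M)"
proof -
  interpret M: sigma_finite_measure M by fact
  define c where "c q = (\<integral>\<^sup>+y\<in>Q q. f y \<partial>M) / emeasure M (Q q)" for q
  define S where "S x = (SUP q\<in>F. c q * indicator (Q q) x)" for x
  have Q_space: "Q q \<subseteq> space M" if "q \<in> F" for q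
    using sets[OF that] by (rule sets.sets_into_space)
  have [measurable]: "S \<in> borel_measurable M"
    unfolding S_def using F(1) by (intro borel_measurable_SUP) (auto simp: countable_finite)
  have weak: "ennreal l * (\<integral>\<^sup>+x. 1 * indicator {x. ennreal l < S x} x \<partial>M)
      \<le> 2 * (\<integral>\<^sup>+x. f x * indicator {x. ennreal l < 2 * f x} x \<partial>M)" if "0 < l" for l
  proof -
    define h where "h x = f x * indicator {x. ennreal l < 2 * f x} x" for x
    have [measurable]: "h \<in> borel_measurable M"
      unfolding h_def by measurable
    define F' where "F' = {q\<in>F. ennreal l < c q}"
    have "ennreal l * emeasure M (Q q) \<le> 2 * emeasure (density M h) (Q q)" if "q \<in> F'" for q
    proof -
      from that have [measurable]: "Q q \<in> sets M" and q: "q \<in> F"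
        by (auto simp: F'_def)
      have "ennreal l * emeasure M (Q q) \<le> c q * emeasure M (Q q)"
        using that by (intro mult_right_mono) (auto simp: F'_def)
      also have "\<dots> \<le> (\<integral>\<^sup>+y\<in>Q q. f y \<partial>M)"
        using fin[OF q] by (cases "emeasure M (Q q) = 0") (auto simp: c_def ennreal_divide_times)
      \<comment> \<open>Where \<open>h\<close> differs from \<open>f\<close>, the latter is at most
        \<open>l / 2\<close>; this part is absorbed into the left-hand side.\<close>
      also have "\<dots> \<le> (\<integral>\<^sup>+y. h y * indicator (Q q) y + ennreal (l / 2) * indicator (Q q) y \<partial>M)"
      proof (intro nn_integral_mono)
        fix y
        have "f y \<le> ennreal (l / 2)" if "\<not> ennreal l < 2 * f y"
          using that \<open>0 < l\<close> by (cases "f y") (auto simp: ennreal_less_iff simp flip: ennreal_numeral ennreal_mult)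
        then show "f y * indicator (Q q) y \<le> h y * indicator (Q q) y + ennreal (l / 2) * indicator (Q q) y"
          by (auto simp: h_def indicator_def)
      qed
      also have "\<dots> = emeasure (density M h) (Q q) + ennreal (l / 2) * emeasure M (Q q)"
        by (subst nn_integral_add) (auto simp: emeasure_density nn_integral_cmult)
      finally have "ennreal (l / 2) * emeasure M (Q q) + ennreal (l / 2) * emeasure M (Q q) \<le>
          emeasure (density M h) (Q q) + ennreal (l / 2) * emeasure M (Q q)"
        using \<open>0 < l\<close> by (simp flip: distrib_right ennreal_plus)
      \<comment> \<open>Half of the left-hand side cancels because \<open>Q q\<close> has finite
        measure.\<close>
      then have "ennreal (l / 2) * emeasure M (Q q) \<le> emeasure (density M h) (Q q)"
        using fin[OF q] by (auto simp: ennreal_mult_eq_top_iff)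
      then have "2 * (ennreal (l / 2) * emeasure M (Q q)) \<le> 2 * emeasure (density M h) (Q q)"
        by (rule mult_left_mono) simp
      then show ?thesis
        using \<open>0 < l\<close> by (simp add: mult.assoc[symmetric] flip: ennreal_numeral ennreal_mult)
    qed
    then have "ennreal l * emeasure M (\<Union>q\<in>F'. Q q) \<le> 2 * emeasure (density M h) (\<Union>q\<in>F'. Q q)"
      using F laminar_mono[OF F(2), of F']
      by (intro emeasure_laminar_Union_le) (auto simp: F'_def sets)
    also have "(\<Union>q\<in>F'. Q q) = {x \<in> space M. ennreal l < S x}"
      unfolding S_def less_SUP_indicator_iff using Q_space by (auto simp: F'_def)
    also have "emeasure (density M h) {x \<in> space M. ennreal l < S x} \<le> emeasure (density M h) (space M)"
      by (intro emeasure_mono) auto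
    also have "\<dots> = (\<integral>\<^sup>+x. h x \<partial>M)"
      by (subst emeasure_density) (auto intro!: nn_integral_cong)
    also have "emeasure M {x \<in> space M. ennreal l < S x} = (\<integral>\<^sup>+x. 1 * indicator {x. ennreal l < S x} x \<partial>M)"
      by (simp only: nn_integral_level_set[OF \<open>S \<in> borel_measurable M\<close>])
    finally show ?thesis
      by (simp add: h_def mult_left_mono)
  qed
  have "(\<integral>\<^sup>+x. S x epowr r \<partial>M) = (\<integral>\<^sup>+l. ennreal (r * l powr (r - 1)) * indicator {0<..} l *
      (\<integral>\<^sup>+x. 1 * indicator {x. ennreal l < S x} x \<partial>M) \<partial>lborel)"
    using nn_integral_layer_cake[OF assms(1), of r "\<lambda>_. 1" S] \<open>1 < r\<close> by simp
  \<comment> \<open>The weak estimate consumes one factor \<open>l\<close>; what remains is the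
    layer cake weight for the exponent \<open>r - 1\<close>, up to the factor
    \<open>2 * r / (r - 1)\<close>.\<close>
  also have "\<dots> \<le> (\<integral>\<^sup>+l. ennreal (2 * r / (r - 1)) * (ennreal ((r - 1) * l powr ((r - 1) - 1)) * indicator {0<..} l *
      (\<integral>\<^sup>+x. f x * indicator {x. ennreal l < 2 * f x} x \<partial>M)) \<partial>lborel)"
  proof (intro nn_integral_mono)
    fix l :: real
    show "ennreal (r * l powr (r - 1)) * indicator {0<..} l * (\<integral>\<^sup>+x. 1 * indicator {x. ennreal l < S x} x \<partial>M)
      \<le> ennreal (2 * r / (r - 1)) * (ennreal ((r - 1) * l powr ((r - 1) - 1)) * indicator {0<..} l *
      (\<integral>\<^sup>+x. f x * indicator {x. ennreal l < 2 * f x} x \<partial>M))"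
    proof (cases "0 < l")
      case True
      let ?I = "\<integral>\<^sup>+x. 1 * indicator {x. ennreal l < S x} x \<partial>M"
      let ?J = "\<integral>\<^sup>+x. f x * indicator {x. ennreal l < 2 * f x} x \<partial>M"
      have "r * l powr (r - 1) = (r * l powr (r - 2)) * l"
        using True by (simp add: powr_diff power2_eq_square field_simps)
      then have "ennreal (r * l powr (r - 1)) * ?I = ennreal (r * l powr (r - 2)) * (ennreal l * ?I)"
        using True \<open>1 < r\<close> by (simp add: ennreal_mult mult.assoc)
      also have "\<dots> \<le> ennreal (r * l powr (r - 2)) * (2 * ?J)"
        by (intro mult_left_mono weak True) simp
      also have "\<dots> = ennreal (2 * r / (r - 1)) * (ennreal ((r - 1) * l powr ((r - 1) - 1)) * ?J)"
        using \<open>1 < r\<close> by (simp add: mult.assoc[symmetric] mult.commute[of _ 2] flip: ennreal_numeral ennreal_mult)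
      finally show ?thesis using True by simp
    qed simp
  qed
  also have "\<dots> = ennreal (2 * r / (r - 1)) * (\<integral>\<^sup>+x. f x * (2 * f x) epowr (r - 1) \<partial>M)"
    using nn_integral_layer_cake[OF assms(1), of "r - 1" f "\<lambda>x. 2 * f x"] \<open>1 < r\<close>
    by (subst nn_integral_cmult) auto
  also have "(\<integral>\<^sup>+x. f x * (2 * f x) epowr (r - 1) \<partial>M) = (\<integral>\<^sup>+x. ennreal (2 powr (r - 1)) * f x epowr r \<partial>M)"
  proof (intro nn_integral_cong)
    fix x
    have "2 epowr (r - 1) = ennreal (2 powr (r - 1))"
      using ennreal_epowr[of 2 "r - 1"] by simp
    then show "f x * (2 * f x) epowr (r - 1) = ennreal (2 powr (r - 1)) * f x epowr r"
      using epowr_add[of 1 "r - 1" "f x"] \<open>1 < r\<close> by (simp add: epowr_mult ac_simps)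
  qed
  also have "\<dots> = ennreal (2 powr (r - 1)) * (\<integral>\<^sup>+x. f x epowr r \<partial>M)"
    by (intro nn_integral_cmult) measurable
  also have "ennreal (2 * r / (r - 1)) * (ennreal (2 powr (r - 1)) * (\<integral>\<^sup>+x. f x epowr r \<partial>M)) =
      ennreal (2 powr r * (r / (r - 1))) * (\<integral>\<^sup>+x. f x epowr r \<partial>M)"
  proof -
    have "2 * r / (r - 1) * 2 powr (r - 1) = 2 powr r * (r / (r - 1))"
      using \<open>1 < r\<close> by (simp add: powr_diff field_simps)
    moreover have "0 \<le> 2 * r / (r - 1)"
      using \<open>1 < r\<close> by simp
    ultimately have "ennreal (2 * r / (r - 1)) * ennreal (2 powr (r - 1)) = ennreal (2 powr r * (r / (r - 1)))"
      by (metis ennreal_mult powr_ge_zero)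
    then show ?thesis
      by (simp only: mult.assoc[symmetric])
  qed
  finally show ?thesis
    by (simp add: S_def c_def)
qed

text \<open>Linearization of a finite supremum: \<open>E q\<close> collects points at which the term
  of \<open>q\<close> attains it. One index is added at a time.\<close>

lemma SUP_indicator_disjoint:
  fixes a :: "'i \<Rightarrow> ennreal"
  assumes "finite F" "\<And>q. q \<in> F \<Longrightarrow> Q q \<in> sets M"
  obtains E where "\<And>q. q \<in> F \<Longrightarrow> E q \<in> sets M" "\<And>q. q \<in> F \<Longrightarrow> E q \<subseteq> Q q" "disjoint_family_on E F"
    "\<And>x. (SUP q\<in>F. a q * indicator (Q q) x) = (\<Sum>q\<in>F. a q * indicator (E q) x)"
proof -
  have "\<exists>E. (\<forall>q\<in>F. E q \<in> sets M \<and> E q \<subseteq> Q q) \<and> disjoint_family_on E F \<and>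
    (\<forall>x. (SUP q\<in>F. a q * indicator (Q q) x) = (\<Sum>q\<in>F. a q * indicator (E q) x))"
    using assms
  proof (induction F rule: finite_induct)
    case empty
    then show ?case by (auto simp: disjoint_family_on_def bot_ennreal)
  next
    case (insert q F)
    then obtain E where E: "\<forall>q\<in>F. E q \<in> sets M \<and> E q \<subseteq> Q q" "disjoint_family_on E F"
      "\<And>x. (SUP q\<in>F. a q * indicator (Q q) x) = (\<Sum>q\<in>F. a q * indicator (E q) x)"
      by auto
    have [measurable]: "\<And>q. q \<in> F \<Longrightarrow> E q \<in> sets M" "Q q \<in> sets M"
      using E insert.prems by auto
    define S where "S x = (SUP q\<in>F. a q * indicator (Q q) x)" for x
    have [measurable]: "S \<in> borel_measurable M"
      unfolding S_def E(3) by measurable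
    \<comment> \<open>The new index takes over exactly where it is strictly larger than the old
      supremum; ties stay with the earlier sets.\<close>
    define B where "B = {x\<in>space M. S x < a q} \<inter> Q q"
    have [measurable]: "B \<in> sets M"
      unfolding B_def by measurable
    define E' where "E' r = (if r = q then B else E r - B)" for r
    have Q: "Q q \<subseteq> space M"
      using insert.prems sets.sets_into_space by auto
    have "(SUP r\<in>insert q F. a r * indicator (Q r) x) = (\<Sum>r\<in>insert q F. a r * indicator (E' r) x)" for x
    proof -
      have "(SUP r\<in>insert q F. a r * indicator (Q r) x) = sup (a q * indicator (Q q) x) (S x)"
        by (simp add: S_def)
      also have "\<dots> = a q * indicator B x + (\<Sum>r\<in>F. a r * indicator (E r - B) x)"
      proof (cases "x \<in> B")
        case True
        then show ?thesis by (auto simp: B_def indicator_def sup_absorb1)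
      next
        case False
        then have "a q * indicator (Q q) x \<le> S x"
          using Q by (auto simp: B_def indicator_def)
        moreover have "(\<Sum>r\<in>F. a r * indicator (E r - B) x) = S x"
          unfolding S_def E(3) using False by (intro sum.cong) (auto simp: indicator_def)
        ultimately show ?thesis using False by (simp add: sup_absorb2)
      qed
      also have "\<dots> = (\<Sum>r\<in>insert q F. a r * indicator (E' r) x)"
      proof -
        have "(\<Sum>r\<in>F. a r * indicator (E r - B) x) = (\<Sum>r\<in>F. a r * indicator (E' r) x)"
          using insert.hyps by (intro sum.cong) (auto simp: E'_def)
        moreover have "E' q = B"
          by (simp add: E'_def)
        ultimately show ?thesis
          by (simp only: sum.insert[OF insert.hyps])
      qed
      finally show ?thesis .
    qed
    moreover have "disjoint_family_on E' (insert q F)"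
      using E(2) by (auto simp: disjoint_family_on_def E'_def)
    moreover have "\<forall>r\<in>insert q F. E' r \<in> sets M \<and> E' r \<subseteq> Q r"
      using E(1) by (auto simp: E'_def B_def)
    ultimately show ?case by blast
  qed
  then show ?thesis using that by blast
qed

lemma emeasure_cube:
  fixes a :: "real ^ 'd"
  assumes "0 < l"
  shows "emeasure lborel (cbox a (a + vec l)) = ennreal (l ^ CARD('d))"
    and "emeasure lebesgue (cbox a (a + vec l)) = ennreal (l ^ CARD('d))"
proof -
  have "measure lborel (cbox a (a + vec l)) = l ^ CARD('d)"
    using assms by (subst content_cbox_cart) (auto simp: interval_ne_empty_cart less_imp_le)
  moreover have "emeasure lborel (cbox a (a + vec l)) \<noteq> \<infinity>"
    using emeasure_lborel_cbox_finite less_top by auto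
  ultimately show "emeasure lborel (cbox a (a + vec l)) = ennreal (l ^ CARD('d))"
    by (simp add: emeasure_eq_ennreal_measure)
  then show "emeasure lebesgue (cbox a (a + vec l)) = ennreal (l ^ CARD('d))"
    by simp
qed

section \<open>Shifted \<open>N\<close>-adic grids\<close>

text \<open>
  The grid has scale \<open>N powr (- k)\<close> at level \<open>k\<close>. A shift by \<open>1 / (N - 1)\<close> of the side length at every level,
  in the coordinates from \<open>S\<close>, keeps the levels nested because \<open>N / (N - 1) = 1 + 1 / (N - 1)\<close>.
\<close>

locale nadic_grid =
  fixes N :: nat and S :: "'d::finite set"
  assumes N_ge_3: "3 \<le> N"
begin

definition offset :: "'d \<Rightarrow> real" where
  "offset j = (if j \<in> S then 1 / (real N - 1) else 0)"

text \<open>A larger \<open>k\<close> means a finer grid; the pair \<open>(k, idx k x)\<close> names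
  the cell of level \<open>k\<close> through \<open>x\<close>.\<close>

definition idx :: "int \<Rightarrow> real ^ 'd \<Rightarrow> int ^ 'd" where
  "idx k x = (\<chi> j. \<lfloor>real N powr k * x $ j - offset j\<rfloor>)"

definition cell :: "int \<times> (int ^ 'd) \<Rightarrow> (real ^ 'd) set" where
  "cell q = {x. idx (fst q) x = snd q}"

definition len :: "int \<times> (int ^ 'd) \<Rightarrow> real" where
  "len q = real N powr (- fst q)"

definition corner :: "int \<times> (int ^ 'd) \<Rightarrow> real ^ 'd" where
  "corner q = (\<chi> j. (snd q $ j + offset j) * len q)"

text \<open>The half-open cells are nested or disjoint, while the closed ones belong to
  \<open>cubes\<close>. They differ by null sets, so each kind is used where it fits.\<close>

definition closed_cell :: "int \<times> (int ^ 'd) \<Rightarrow> (real ^ 'd) set" where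
  "closed_cell q = cbox (corner q) (corner q + vec (len q))"

text \<open>The parent cell. In shifted coordinates the index is lowered by 1 before the division
  because \<open>(real N - 1) * offset j = 1\<close> there.\<close>

definition up :: "int \<times> (int ^ 'd) \<Rightarrow> int \<times> (int ^ 'd)" where
  "up q = (fst q - 1, \<chi> j. (snd q $ j - (if j \<in> S then 1 else 0)) div int N)"

lemma N_pos [simp]: "0 < real N" "1 < real N" "0 < N" "Suc 0 < N" "2 \<le> real N - 1"
  using N_ge_3 by auto

lemma len_pos [simp]: "0 < len q" "len q \<noteq> 0" "0 \<le> len q"
  by (simp_all add: len_def)

lemma mem_cell_iff: "x \<in> cell q \<longleftrightarrow> (\<forall>j. corner q $ j \<le> x $ j \<and> x $ j < corner q $ j + len q)"
proof -
  have inv: "real N powr fst q * len q = 1"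
    by (simp add: len_def flip: powr_add)
  have "\<lfloor>real N powr fst q * x $ j - offset j\<rfloor> = snd q $ j \<longleftrightarrow>
      corner q $ j \<le> x $ j \<and> x $ j < corner q $ j + len q" for j
  proof -
    define y where "y = real N powr fst q * x $ j"
    have x: "x $ j = y * len q"
      using inv by (simp add: y_def ac_simps)
    have "corner q $ j \<le> x $ j \<longleftrightarrow> snd q $ j + offset j \<le> y"
      by (simp add: corner_def x)
    moreover have "x $ j < corner q $ j + len q \<longleftrightarrow> y < snd q $ j + offset j + 1"
    proof -
      have "corner q $ j + len q = (snd q $ j + offset j + 1) * len q"
        by (simp add: corner_def distrib_right)
      then show ?thesis
        unfolding x by (simp only: mult_less_cancel_right_pos len_pos)
    qed
    moreover have "\<lfloor>y - offset j\<rfloor> = snd q $ j \<longleftrightarrow> snd q $ j + offset j \<le> y \<and> y < snd q $ j + offset j + 1"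
      unfolding floor_eq_iff by linarith
    ultimately show ?thesis
      by (simp add: y_def)
  qed
  then show ?thesis
    by (simp add: cell_def idx_def vec_eq_iff)
qed

lemma cell_alt: "cell q = {x. \<forall>j. corner q $ j \<le> x $ j \<and> x $ j < corner q $ j + len q}"
  using mem_cell_iff by blast

lemma idx_mem_cell: "x \<in> cell (k, idx k x)"
  by (simp add: cell_def)

lemma corner_mem_cell: "corner q \<in> cell q"
  by (simp add: mem_cell_iff)

lemma cell_borel [measurable]: "cell q \<in> sets borel"
  unfolding cell_alt by measurable

lemma cell_sets [measurable]: "cell q \<in> sets lebesgue"
  using cell_borel by simp

lemma box_subset_cell: "box (corner q) (corner q + vec (len q)) \<subseteq> cell q"
  by (auto simp: mem_cell_iff mem_box_cart less_imp_le)

lemma cell_subset_closed_cell: "cell q \<subseteq> closed_cell q"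
  by (auto simp: mem_cell_iff closed_cell_def mem_box_cart less_imp_le)

lemma closed_cell_mem_cubes: "closed_cell q \<in> cubes"
  unfolding closed_cell_def cubes_def using len_pos(1) by blast

lemma cell_mono_bounds:
  assumes "cell q \<subseteq> cell r"
  shows "corner r $ j \<le> corner q $ j" "corner q $ j + len q \<le> corner r $ j + len r"
proof -
  show "corner r $ j \<le> corner q $ j"
    using assms corner_mem_cell[of q] mem_cell_iff[of "corner q" r] by blast
  show "corner q $ j + len q \<le> corner r $ j + len r"
  proof (rule field_le_epsilon)
    fix e :: real assume "0 < e"
    \<comment> \<open>The right end point is missing from a half-open cell, so it is approached up
      to \<open>e'\<close>; the bound by \<open>len q\<close> keeps the point inside the
      cell.\<close>
    define e' where "e' = min e (len q)"
    have "corner q + vec (len q - e') \<in> cell q"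
      using \<open>0 < e\<close> by (auto simp: mem_cell_iff e'_def)
    with assms have "corner q + vec (len q - e') \<in> cell r" by blast
    then have "(corner q + vec (len q - e')) $ j < corner r $ j + len r"
      unfolding mem_cell_iff by blast
    then have "corner q $ j + len q - e' < corner r $ j + len r"
      by simp
    then show "corner q $ j + len q \<le> corner r $ j + len r + e"
      by (simp add: e'_def min_def split: if_splits)
  qed
qed

lemma closed_cell_mono: "cell q \<subseteq> cell r \<Longrightarrow> closed_cell q \<subseteq> closed_cell r"
  unfolding closed_cell_def subset_interval_cart using cell_mono_bounds[of q r] by auto

lemma level_mono:
  assumes "cell q \<subseteq> cell r" shows "fst r \<le> fst q"
proof -
  have "len q \<le> len r"
    using cell_mono_bounds[OF assms, of undefined] by linarith
  then show ?thesis
    unfolding len_def by (subst (asm) powr_le_cancel_iff) auto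
qed

lemma idx_up: "up (k, idx k x) = (k - 1, idx (k - 1) x)"
proof -
  have "(\<lfloor>real N powr k * x $ j - offset j\<rfloor> - (if j \<in> S then 1 else 0)) div int N =
      \<lfloor>real N powr (k - 1) * x $ j - offset j\<rfloor>" for j
  proof -
    define c :: int where "c = (if j \<in> S then 1 else 0)"
    have c: "(real N - 1) * offset j = c"
      using N_ge_3 by (auto simp: c_def offset_def)
    have "real N powr (k - 1) * x $ j - offset j = (real N powr k * x $ j - offset j - c) / real_of_int (int N)"
      unfolding c[symmetric] by (simp add: powr_diff field_simps)
    then have "\<lfloor>real N powr (k - 1) * x $ j - offset j\<rfloor> = \<lfloor>real N powr k * x $ j - offset j - c\<rfloor> div int N"
      by (simp only: floor_divide_real_eq_div of_nat_0_le_iff)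
    then show ?thesis
      by (simp add: c_def)
  qed
  then show ?thesis
    by (simp add: up_def idx_def)
qed

lemma cell_subset_up: "cell q \<subseteq> cell (up q)"
  using idx_up by (cases q) (auto simp: cell_def up_def)

lemma idx_coarsen:
  assumes "k \<le> l" "idx l x = idx l y" shows "idx k x = idx k y"
proof -
  have "idx l x = idx l y \<Longrightarrow> idx k x = idx k y" if "k \<le> l" for l
    using that
  proof (induction l rule: int_ge_induct)
    case (step l)
    then show ?case
      using idx_up[of "l + 1" x] idx_up[of "l + 1" y] by simp
  qed
  with assms show ?thesis by blast
qed

lemma cell_nested:
  assumes "x \<in> cell q" "x \<in> cell r" "fst r \<le> fst q" shows "cell q \<subseteq> cell r"
proof
  fix y assume "y \<in> cell q"
  with assms(1) have "idx (fst q) y = idx (fst q) x"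
    by (simp add: cell_def)
  from idx_coarsen[OF assms(3) this] assms(2) show "y \<in> cell r"
    by (simp add: cell_def)
qed

lemma laminar_cell: "laminar cell F"
  unfolding laminar_def using cell_nested by (metis disjoint_iff linorder_linear)

lemma cell_eqI: "cell q \<subseteq> cell r \<Longrightarrow> fst q = fst r \<Longrightarrow> q = r"
  using corner_mem_cell[of q] by (auto simp: cell_def prod_eq_iff)

lemma cell_subset_child:
  assumes "cell q \<subseteq> cell r" "fst r < fst q"
  obtains c where "up c = r" "cell q \<subseteq> cell c" "fst c = fst r + 1"
proof
  \<comment> \<open>The cell one level below \<open>r\<close> that contains the corner of
    \<open>q\<close>; it is not finer than \<open>q\<close>, so nesting applies.\<close>
  let ?c = "(fst r + 1, idx (fst r + 1) (corner q))"
  have "corner q \<in> cell r"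
    using assms corner_mem_cell by blast
  then show "up ?c = r"
    unfolding idx_up by (simp add: cell_def prod_eq_iff)
  show "cell q \<subseteq> cell ?c"
    using assms corner_mem_cell idx_mem_cell by (intro cell_nested[of "corner q"]) auto
qed simp

lemma finite_children: "finite {c. up c = r}"
  and card_children: "card {c. up c = r} \<le> N ^ CARD('d)"
proof -
  \<comment> \<open>The integers with a prescribed quotient by \<open>N\<close> after the shift:
    \<open>N\<close> consecutive values in each coordinate.\<close>
  define B where "B j = {int N * snd r $ j + (if j \<in> S then 1 else 0) ..< int N * snd r $ j + (if j \<in> S then 1 else 0) + int N}" for j
  have "{c. up c = r} \<subseteq> (\<lambda>f. (fst r + 1, \<chi> j. f j)) ` (PiE UNIV B)"
  proof
    fix c assume "c \<in> {c. up c = r}"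
    then have "up c = r" by simp
    then have "(snd c $ j - (if j \<in> S then 1 else 0)) div int N = snd r $ j" for j
      by (auto simp: up_def)
    moreover have "int N * ((w - e) div int N) + e \<le> w \<and> w < int N * ((w - e) div int N) + e + int N" for w e :: int
    proof -
      have "0 < int N" by simp
      from mult_div_mod_eq[of "int N" "w - e"] pos_mod_bound[OF this, of "w - e"] pos_mod_sign[OF this, of "w - e"]
      show ?thesis by linarith
    qed
    ultimately have "snd c $ j \<in> B j" for j
      unfolding B_def by (metis atLeastLessThan_iff)
    moreover have "fst c = fst r + 1"
      using \<open>up c = r\<close> by (auto simp: up_def)
    ultimately show "c \<in> (\<lambda>f. (fst r + 1, \<chi> j. f j)) ` (PiE UNIV B)"
      by (intro image_eqI[of _ _ "\<lambda>j. snd c $ j"]) (auto simp: prod_eq_iff vec_eq_iff)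
  qed
  moreover have fin: "finite (PiE UNIV B)"
    by (intro finite_PiE) (auto simp: B_def)
  moreover have "card (PiE UNIV B) = N ^ CARD('d)"
    by (subst card_PiE) (auto simp: B_def)
  ultimately show "finite {c. up c = r}" "card {c. up c = r} \<le> N ^ CARD('d)"
    by (metis finite_imageI finite_subset, metis surj_card_le)
qed

lemma emeasure_closed_cell: "emeasure lebesgue (closed_cell q) = ennreal (len q ^ CARD('d))"
  by (simp add: closed_cell_def emeasure_cube)

lemma AE_cell_eq: "AE x in lebesgue. x \<in> cell q \<longleftrightarrow> x \<in> closed_cell q"
proof -
  have "closed_cell q - box (corner q) (corner q + vec (len q)) \<in> null_sets lebesgue"
    unfolding closed_cell_def using negligible_frontier_interval negligible_iff_null_sets by blast
  then show ?thesis
    by (rule AE_I') (use box_subset_cell[of q] cell_subset_closed_cell[of q] in auto)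
qed

lemma set_nn_integral_cell: "(\<integral>\<^sup>+x\<in>cell q. f x \<partial>lebesgue) = (\<integral>\<^sup>+x\<in>closed_cell q. f x \<partial>lebesgue)"
  using AE_cell_eq[of q] by (intro nn_integral_cong_AE) (auto elim!: eventually_mono simp: indicator_def)

lemma mass_cell: "mass w (cell q) = mass w (closed_cell q)"
  by (simp add: mass_def set_nn_integral_cell)

lemma side_length_closed_cell: "side_length (closed_cell q) = len q"
proof -
  have "measure lebesgue (closed_cell q) = len q ^ CARD('d)"
    by (simp add: measure_def emeasure_closed_cell)
  then show ?thesis
    by (simp add: side_length_def powr_realpow[symmetric] powr_powr)
qed

lemma len_up: "len (up q) = real N * len q"
  by (simp add: len_def up_def powr_diff powr_minus field_simps powr_add)

end

text \<open>
  The one-third trick: a short interval meets at most one of the two interlaced sets of endpoints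
  \<open>\<int>\<close> and \<open>\<int> + 1 / (N - 1)\<close>.
\<close>

lemma interval_avoids_endpoints:
  fixes a b :: real and N :: nat
  assumes "3 \<le> N" "a \<le> b" "b - a < 1 / (real N - 1)" "\<lfloor>a\<rfloor> \<noteq> \<lfloor>b\<rfloor>"
  shows "\<lfloor>a - 1 / (real N - 1)\<rfloor> = \<lfloor>b - 1 / (real N - 1)\<rfloor>"
proof (rule ccontr)
  define t where "t = 1 / (real N - 1)"
  have t: "0 < t" "2 * t \<le> 1"
    using assms(1) by (auto simp: t_def field_simps)
  assume "\<lfloor>a - 1 / (real N - 1)\<rfloor> \<noteq> \<lfloor>b - 1 / (real N - 1)\<rfloor>"
  then have "\<lfloor>a - t\<rfloor> < \<lfloor>b - t\<rfloor>"
    using floor_mono[of "a - t" "b - t"] assms(2) by (auto simp: t_def)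
  moreover have "\<lfloor>a\<rfloor> < \<lfloor>b\<rfloor>"
    using floor_mono[OF assms(2)] assms(4) by auto
  ultimately have "a < \<lfloor>b\<rfloor>" "real_of_int \<lfloor>b\<rfloor> \<le> b" "a - t < \<lfloor>b - t\<rfloor>" "real_of_int \<lfloor>b - t\<rfloor> \<le> b - t"
    by (simp_all only: floor_less_iff of_int_floor_le)
  then have "real_of_int \<lfloor>b\<rfloor> - real_of_int \<lfloor>b - t\<rfloor> < 2 * t" "0 < real_of_int \<lfloor>b\<rfloor> - real_of_int \<lfloor>b - t\<rfloor>"
    using assms(3) unfolding t_def[symmetric] by linarith+
  with t have "real_of_int (\<lfloor>b\<rfloor> - \<lfloor>b - t\<rfloor>) < 1" "0 < real_of_int (\<lfloor>b\<rfloor> - \<lfloor>b - t\<rfloor>)"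
    by simp_all
  then show False
    by (simp only: of_int_less_1_iff of_int_0_less_iff)
qed

text \<open>At a level where the sides of \<open>Q\<close> are shorter than the shift, each
  coordinate can use whichever of the two interlaced grids does not cut the side.\<close>

lemma cube_subset_cell:
  fixes Q :: "(real ^ 'd) set"
  assumes N: "3 \<le> N" and "Q \<in> cubes"
  obtains S q where "Q \<subseteq> nadic_grid.cell N S q"
    "nadic_grid.len N q ^ CARD('d) \<le> (real N ^ 2) ^ CARD('d) * measure lebesgue Q"
proof -
  obtain a l where Q: "Q = cbox a (a + vec l)" "0 < l"
    using assms(2) by (auto simp: cubes_def)
  define t where "t = 1 / (real N - 1)"
  have N': "0 < real N" "1 < real N" "2 \<le> real N - 1"
    using N by auto
  \<comment> \<open>The largest level with \<open>real N powr k * l < t\<close>; maximality bounds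
    the cell length by \<open>real N ^ 2 * l\<close>.\<close>
  define k where "k = \<lceil>log N (t / l)\<rceil> - 1"
  have "0 < t" using N' by (simp add: t_def)
  have "k < log N (t / l)" "log N (t / l) \<le> k + 1"
    unfolding k_def by linarith+
  then have "real N powr k < real N powr log N (t / l)" "real N powr log N (t / l) \<le> real N powr (k + 1)"
    using N' by (auto intro: powr_less_mono powr_mono)
  moreover have "real N powr log N (t / l) = t / l"
    using N' Q(2) \<open>0 < t\<close> by (intro powr_log_cancel) auto
  ultimately have k: "real N powr k * l < t" "t \<le> real N powr (k + 1) * l"
    using Q(2) by (auto simp: pos_less_divide_eq pos_divide_le_eq)
  \<comment> \<open>The coordinates in which the unshifted grid cuts \<open>Q\<close>; exactly these
    are shifted.\<close>
  define A where "A = {j. \<lfloor>N powr k * a $ j\<rfloor> \<noteq> \<lfloor>N powr k * (a $ j + l)\<rfloor>}"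
  interpret nadic_grid N A
    by standard (rule N)
  define q where "q = (k, idx k a)"
  have end_eq: "\<lfloor>real N powr k * (a $ j + l) - offset j\<rfloor> = \<lfloor>real N powr k * a $ j - offset j\<rfloor>" for j
  proof (cases "j \<in> A")
    case True
    then have "\<lfloor>N powr k * a $ j\<rfloor> \<noteq> \<lfloor>N powr k * (a $ j + l)\<rfloor>"
      by (simp add: A_def)
    then have "\<lfloor>N powr k * a $ j - t\<rfloor> = \<lfloor>N powr k * (a $ j + l) - t\<rfloor>"
      unfolding t_def using k(1) Q(2)
      by (intro interval_avoids_endpoints[OF N]) (auto simp: distrib_left t_def)
    then show ?thesis
      using True by (simp add: offset_def t_def)
  next
    case False
    then have "\<lfloor>N powr k * a $ j\<rfloor> = \<lfloor>N powr k * (a $ j + l)\<rfloor>"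
      by (simp add: A_def)
    then show ?thesis
      using False by (simp add: offset_def)
  qed
  have "Q \<subseteq> cell q"
  proof
    fix x assume "x \<in> Q"
    then have x: "a $ j \<le> x $ j" "x $ j \<le> a $ j + l" for j
      by (auto simp: Q mem_box_cart)
    have "\<lfloor>real N powr k * x $ j - offset j\<rfloor> = \<lfloor>real N powr k * a $ j - offset j\<rfloor>" for j
    proof (rule antisym)
      show "\<lfloor>real N powr k * x $ j - offset j\<rfloor> \<le> \<lfloor>real N powr k * a $ j - offset j\<rfloor>"
        unfolding end_eq[symmetric] using x by (intro floor_mono diff_right_mono mult_left_mono) auto
      show "\<lfloor>real N powr k * x $ j - offset j\<rfloor> \<ge> \<lfloor>real N powr k * a $ j - offset j\<rfloor>"
        using x by (intro floor_mono diff_right_mono mult_left_mono) auto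
    qed
    then show "x \<in> cell q"
      by (simp add: cell_def q_def idx_def vec_eq_iff)
  qed
  moreover have "len q ^ CARD('d) \<le> (real N ^ 2) ^ CARD('d) * measure lebesgue Q"
  proof -
    have "1 \<le> (real N - 1) * real N powr (k + 1) * l"
      using k(2) N' by (simp add: t_def field_simps)
    also have "\<dots> \<le> real N * real N powr (k + 1) * l"
      using N' Q by (intro mult_right_mono) auto
    also have "\<dots> = real N powr k * (real N ^ 2 * l)"
      using N' by (simp add: powr_add power2_eq_square)
    finally have "len q * 1 \<le> len q * (real N powr k * (real N ^ 2 * l))"
      by (intro mult_left_mono) auto
    also have "\<dots> = real N ^ 2 * l"
      by (simp add: len_def q_def powr_minus)
    finally have "len q ^ CARD('d) \<le> (real N ^ 2 * l) ^ CARD('d)"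
      by (intro power_mono) auto
    moreover have "measure lebesgue Q = l ^ CARD('d)"
      using emeasure_cube(2)[OF Q(2), of a] Q by (simp add: measure_def)
    ultimately show ?thesis
      by (simp add: power_mult_distrib)
  qed
  ultimately show ?thesis
    using that by blast
qed

section \<open>Weights and the constants\<close>

declare emeasure_completion [simp del]

lemma cube_sets [measurable_dest, simp]: "Q \<in> cubes \<Longrightarrow> Q \<in> sets lebesgue"
  by (auto simp: cubes_def)

lemma cube_compact: "Q \<in> cubes \<Longrightarrow> compact Q"
  by (auto simp: cubes_def)

lemma emeasure_cube_nontrivial:
  assumes "Q \<in> cubes" shows "emeasure lebesgue Q \<noteq> 0" "emeasure lebesgue Q \<noteq> top"
  using assms by (auto simp: cubes_def emeasure_cube)

lemma ex_cube_cover: "\<exists>A. countable A \<and> A \<subseteq> cubes \<and> \<Union>A = (UNIV :: (real ^ 'd) set)"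
proof (intro exI conjI)
  define C :: "nat \<Rightarrow> (real ^ 'd) set" where "C n = cbox (vec (- real n - 1)) (vec (- real n - 1) + vec (2 * real n + 2))" for n
  show "countable (range C)" by simp
  show "range C \<subseteq> cubes"
    unfolding cubes_def C_def by (auto intro!: exI[of _ "2 * real _ + 2"])
  have "x \<in> \<Union> (range C)" for x
  proof -
    obtain n where "norm x < real n" using reals_Archimedean2 by blast
    then have "\<bar>x $ j\<bar> < real n" for j
      using component_le_norm_cart[of x j] by simp
    then have "- real n - 1 \<le> x $ j \<and> x $ j \<le> - real n - 1 + (2 * real n + 2)" for j
      by (smt (verit))
    then have "x \<in> C n"
      by (simp add: C_def mem_box_cart)
    then show ?thesis by blast
  qed
  then show "\<Union> (range C) = UNIV" by blast
qed

text \<open>Local integrability gives measurability of the truncations to balls, which at each point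
  are eventually equal to \<open>w\<close>.\<close>

lemma weight_measurable [measurable_dest]:
  fixes w :: "real ^ 'd \<Rightarrow> real"
  assumes "weight w" shows "w \<in> borel_measurable lebesgue"
proof (rule borel_measurable_LIMSEQ_real)
  show "(\<lambda>x. indicator (cball 0 (real n)) x *\<^sub>R w x) \<in> borel_measurable lebesgue" for n
    using assms compact_cball[of 0 "real n"] unfolding weight_def set_integrable_def
    by (intro borel_measurable_integrable) blast
  fix x :: "real ^ 'd"
  obtain m where "norm x < real m" using reals_Archimedean2 by blast
  then have "eventually (\<lambda>n. indicator (cball 0 (real n)) x *\<^sub>R w x = w x) sequentially"
    unfolding eventually_sequentially by (intro exI[of _ m]) (auto simp: indicator_def)
  then show "(\<lambda>n. indicator (cball 0 (real n)) x *\<^sub>R w x) \<longlonglongrightarrow> w x"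
    by (rule tendsto_eventually)
qed

lemma weight_nonneg: "weight w \<Longrightarrow> 0 \<le> w x"
  by (simp add: weight_def)

lemma mass_cube_finite:
  assumes "weight w" "Q \<in> cubes" shows "mass w Q < top"
proof -
  have "integrable lebesgue (\<lambda>x. indicator Q x *\<^sub>R w x)"
    using assms cube_compact unfolding weight_def set_integrable_def by blast
  then have "(\<integral>\<^sup>+x. ennreal (norm (indicator Q x *\<^sub>R w x)) \<partial>lebesgue) < \<infinity>"
    by (simp add: integrable_iff_bounded)
  moreover have "ennreal (norm (indicator Q x *\<^sub>R w x)) = ennreal (w x) * indicator Q x" for x
    using weight_nonneg[OF assms(1)] by (simp add: indicator_def)
  ultimately show ?thesis
    by (simp add: mass_def)
qed

lemma sets_weight_measure [simp, measurable_cong]: "sets (weight_measure w) = sets lebesgue"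
  by (simp add: weight_measure_def)

lemma emeasure_weight_measure:
  "w \<in> borel_measurable lebesgue \<Longrightarrow> E \<in> sets lebesgue \<Longrightarrow> emeasure (weight_measure w) E = mass w E"
  unfolding weight_measure_def mass_def by (subst emeasure_density) auto

lemma nn_integral_weight_measure:
  "w \<in> borel_measurable lebesgue \<Longrightarrow> f \<in> borel_measurable lebesgue \<Longrightarrow>
    (\<integral>\<^sup>+x. f x \<partial>weight_measure w) = (\<integral>\<^sup>+x. ennreal (w x) * f x \<partial>lebesgue)"
  unfolding weight_measure_def by (rule nn_integral_density) measurable

text \<open>Stated with finiteness on cubes instead of \<open>weight\<close>, because for
  \<open>\<nu>\<close> below this finiteness comes from Hoelder's inequality.\<close>

lemma sigma_finite_weight_measure:
  fixes w :: "real ^ 'd \<Rightarrow> real"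
  assumes "w \<in> borel_measurable lebesgue" "\<And>Q. Q \<in> cubes \<Longrightarrow> mass w Q < top"
  shows "sigma_finite_measure (weight_measure w)"
proof -
  obtain A :: "(real ^ 'd) set set" where "countable A" "A \<subseteq> cubes" "\<Union>A = UNIV"
    using ex_cube_cover by blast
  with assms show ?thesis
    by (intro sigma_finite_measure.intro exI[of _ A])
      (auto simp: weight_measure_def[THEN arg_cong, of space] subset_iff emeasure_weight_measure dest: less_imp_neq)
qed

lemma mass_mono: "E \<subseteq> E' \<Longrightarrow> mass w E \<le> mass w E'"
  unfolding mass_def by (intro nn_integral_mono) (auto simp: indicator_def)

lemma mass_cong: "(\<And>x. x \<in> E \<Longrightarrow> v x = w x) \<Longrightarrow> mass v E = mass w E"
  unfolding mass_def by (intro nn_integral_cong) (auto simp: indicator_def)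

section \<open>Averages, measurability of the maximal operator, and smallest constants\<close>

lemma average_mult_measure:
  assumes "Q \<in> cubes" shows "average w Q * emeasure lebesgue Q = mass w Q"
  using emeasure_cube_nontrivial[OF assms]
  by (simp add: average_def ennreal_divide_times less_top)

text \<open>The sets where \<open>\<M> f\<close> exceeds \<open>a\<close> are open: a cube through
  \<open>x\<close> with a large product of averages can be enlarged so that \<open>x\<close> becomes
  an interior point, while the product drops by as little as desired.\<close>

lemma borel_measurable_maximal [measurable]:
  fixes f :: "'m::finite \<Rightarrow> real ^ 'd \<Rightarrow> real"
  shows "\<M> f \<in> borel_measurable borel"
proof (rule borel_measurableI_greater)
  fix a :: ennreal
  define m where "m i = mass (\<lambda>y. \<bar>f i y\<bar>)" for i
  \<comment> \<open>Each of the \<open>CARD('m)\<close> averages divides by the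
    \<open>CARD('d)\<close>-th power of the side length.\<close>
  define D where "D = CARD('d) * CARD('m)"
  have prod_eq: "(\<Prod>i\<in>UNIV. b i / ennreal (l ^ CARD('d))) = (\<Prod>i\<in>UNIV. b i) * ennreal (1 / l ^ D)"
    if "0 < l" for l and b :: "'m \<Rightarrow> ennreal"
    using that by (simp add: divide_ennreal_def inverse_ennreal prod.distrib ennreal_power D_def
        inverse_eq_divide power_divide flip: power_mult)
  have "open {x. a < \<M> f x}"
    unfolding open_subopen[of "{x. a < \<M> f x}"]
  proof safe
    fix x assume "a < \<M> f x"
    then obtain Q where "Q \<in> cubes" "x \<in> Q" and less: "a < (\<Prod>i\<in>UNIV. average (\<lambda>y. \<bar>f i y\<bar>) Q)"
      by (auto simp: multilinear_maximal_def less_SUP_iff)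
    then obtain c l where Q: "Q = cbox c (c + vec l)" "0 < l"
      by (auto simp: cubes_def)
    define K where "K = (\<Prod>i\<in>UNIV. m i Q)"
    have less: "a < K * ennreal (1 / l ^ D)"
      using less Q by (simp add: average_def emeasure_cube prod_eq K_def m_def)
    \<comment> \<open>An infinite product of masses allows any enlargement; otherwise the bound is
      continuous in \<open>t\<close> at 0.\<close>
    obtain t where t: "0 < t" "a < K * ennreal (1 / (l + 2 * t) ^ D)"
    proof (cases "K = top")
      case True
      with less Q(2) have "a < K * ennreal (1 / (l + 2 * 1) ^ D)"
        by (simp add: ennreal_top_mult)
      then show ?thesis using that[of 1] by simp
    next
      case False
      have "((\<lambda>t. K * ennreal (1 / (l + 2 * t) ^ D)) \<longlongrightarrow> K * ennreal (1 / (l + 2 * 0) ^ D)) (at_right 0)"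
        using False Q(2) by (intro ennreal_tendsto_cmult tendsto_ennrealI tendsto_intros) (auto simp: less_top)
      then have "eventually (\<lambda>t. a < K * ennreal (1 / (l + 2 * t) ^ D)) (at_right 0)"
        using less by (intro order_tendstoD(1)) auto
      then have "eventually (\<lambda>t. a < K * ennreal (1 / (l + 2 * t) ^ D) \<and> 0 < t) (at_right 0)"
        using eventually_at_right_less by (rule eventually_conj)
      then show ?thesis
        using that eventually_happens'[OF trivial_limit_at_right_real] by blast
    qed
    define Q' where "Q' = cbox (c - vec t) (c - vec t + vec (l + 2 * t))"
    have "Q' \<in> cubes"
      using Q(2) t(1) by (auto simp: Q'_def cubes_def intro!: exI[of _ "c - vec t"] exI[of _ "l + 2 * t"])
    have "Q \<subseteq> Q'"
      using t(1) by (auto simp: Q Q'_def subset_interval_cart)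
    have "K * ennreal (1 / (l + 2 * t) ^ D) \<le> (\<Prod>i\<in>UNIV. average (\<lambda>y. \<bar>f i y\<bar>) Q')"
    proof -
      have "K \<le> (\<Prod>i\<in>UNIV. m i Q')"
        unfolding K_def m_def by (intro prod_mono_ennreal mass_mono \<open>Q \<subseteq> Q'\<close>)
      then show ?thesis
        using Q(2) t(1) unfolding average_def m_def Q'_def
        by (simp add: emeasure_cube prod_eq mult_right_mono)
    qed
    with t(2) have a: "a < (\<Prod>i\<in>UNIV. average (\<lambda>y. \<bar>f i y\<bar>) Q')"
      by simp
    have "box (c - vec t) (c - vec t + vec (l + 2 * t)) \<subseteq> {x. a < \<M> f x}"
    proof safe
      fix y assume "y \<in> box (c - vec t) (c - vec t + vec (l + 2 * t))"
      then have "y \<in> Q'"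
        using box_subset_cbox by (auto simp: Q'_def)
      then have "(\<Prod>i\<in>UNIV. average (\<lambda>y. \<bar>f i y\<bar>) Q') \<le> \<M> f y"
        unfolding multilinear_maximal_def using \<open>Q' \<in> cubes\<close> by (intro SUP_upper) auto
      with a show "a < \<M> f y" by simp
    qed
    moreover have "x \<in> box (c - vec t) (c - vec t + vec (l + 2 * t))"
      unfolding mem_box_cart
    proof
      fix j
      have "c $ j \<le> x $ j" "x $ j \<le> c $ j + l"
        using \<open>x \<in> Q\<close> by (auto simp: Q mem_box_cart)
      with t(1) show "(c - vec t) $ j < x $ j \<and> x $ j < (c - vec t + vec (l + 2 * t)) $ j"
        by simp
    qed
    ultimately show "\<exists>T. open T \<and> x \<in> T \<and> T \<subseteq> {x. a < \<M> f x}"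
      using open_box by blast
  qed
  then show "{x \<in> space borel. a < \<M> f x} \<in> sets borel"
    by simp
qed

lemma maximal_ge:
  "Q \<in> cubes \<Longrightarrow> x \<in> Q \<Longrightarrow> (\<Prod>i\<in>UNIV. average (\<lambda>y. \<bar>f i y\<bar>) Q) \<le> \<M> f x"
  unfolding multilinear_maximal_def by (intro SUP_upper) auto

text \<open>The infimum of the admissible constants is itself admissible. Finiteness of
  \<open>s\<close> permits division by it; for \<open>s = 0\<close> some admissible constant must
  exist, since \<open>Inf {} * 0 = 0\<close>.\<close>

lemma le_Inf_mult:
  fixes s :: ennreal
  assumes "X \<noteq> {}" "\<And>C. C \<in> X \<Longrightarrow> L \<le> C * s" "s < top"
  shows "L \<le> Inf X * s"
proof (cases "s = 0")
  case True
  with assms show ?thesis by auto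
next
  case False
  have "L / s \<le> C" if "C \<in> X" for C
    using divide_right_mono_ennreal[OF assms(2)[OF that], of s] False assms(3)
    by (simp add: ennreal_mult_divide_eq less_top)
  then have "L / s * s \<le> Inf X * s"
    by (intro mult_right_mono Inf_greatest) auto
  then show ?thesis
    using False assms(3) by (simp add: ennreal_divide_times less_top)
qed

lemma Lnorm_powr: "0 < q \<Longrightarrow> Lnorm q w g epowr q = (\<integral>\<^sup>+x. g x epowr q \<partial>weight_measure w)"
  by (simp add: Lnorm_def epowr_inverse)

section \<open>Masses, averages and the three conditions for a fixed tuple of weights\<close>

locale weight_tuple =
  fixes ps :: "'m::finite \<Rightarrow> real" and p :: real
    and \<omega> :: "real ^ 'd \<Rightarrow> real" and \<sigma> :: "'m \<Rightarrow> real ^ 'd \<Rightarrow> real"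
  assumes ps: "\<And>i. 1 < ps i" and p: "0 < p" and exponents: "1 / p = (\<Sum>i\<in>UNIV. 1 / ps i)"
    and weight_\<omega>: "weight \<omega>" and weight_\<sigma>: "\<And>i. weight (\<sigma> i)"
begin

definition s :: "(real ^ 'd) set \<Rightarrow> ennreal" where
  "s Q = (\<Prod>i\<in>UNIV. mass (\<sigma> i) Q epowr (p / ps i))"

text \<open>The density in the reverse Hoelder condition. Its integral is additive over disjoint
  sets, as the Carleson embedding requires; \<open>s\<close> is merely comparable to it.\<close>

definition \<nu> :: "real ^ 'd \<Rightarrow> real" where
  "\<nu> x = (\<Prod>i\<in>UNIV. \<sigma> i x powr (p / ps i))"

lemma exponent_pos: "0 < p / ps i"
  using p ps[of i] by simp

lemma sum_exponents: "(\<Sum>i\<in>UNIV. p / ps i) = 1"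
proof -
  have "(\<Sum>i\<in>UNIV. p / ps i) = p * (1 / p)"
    unfolding exponents sum_distrib_left by simp
  then show ?thesis using p by simp
qed

lemma measurable_weights [measurable]:
  "\<omega> \<in> borel_measurable lebesgue" "\<sigma> i \<in> borel_measurable lebesgue" "\<nu> \<in> borel_measurable lebesgue"
proof -
  show [measurable]: "\<omega> \<in> borel_measurable lebesgue" "\<sigma> i \<in> borel_measurable lebesgue" for i
    using weight_\<omega> weight_\<sigma> weight_measurable by auto
  show "\<nu> \<in> borel_measurable lebesgue"
    unfolding \<nu>_def by measurable
qed

lemma s_eq_0_iff: "s Q = 0 \<longleftrightarrow> (\<exists>i. mass (\<sigma> i) Q = 0)"
  by (auto simp: s_def prod_zero_iff)

lemma s_cube_finite: "Q \<in> cubes \<Longrightarrow> s Q < top"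
  unfolding s_def less_top[symmetric] ennreal_prod_eq_top using mass_cube_finite[OF weight_\<sigma>]
  by (auto simp: less_top)

text \<open>Hoelder's inequality, as the exponents \<open>p / ps i\<close> add up to 1. It also
  makes \<open>mass \<nu>\<close> finite on cubes.\<close>

lemma mass_\<nu>_le_s:
  assumes [measurable]: "Q \<in> sets lebesgue" shows "mass \<nu> Q \<le> s Q"
proof -
  have "ennreal (\<nu> x) * indicator Q x = (\<Prod>i\<in>UNIV. (ennreal (\<sigma> i x) * indicator Q x) epowr (p / ps i))" for x
    using weight_nonneg[OF weight_\<sigma>]
    by (cases "x \<in> Q") (simp_all add: \<nu>_def ennreal_epowr prod_ennreal power_0_left)
  then have "mass \<nu> Q = (\<integral>\<^sup>+x. (\<Prod>i\<in>UNIV. (ennreal (\<sigma> i x) * indicator Q x) epowr (p / ps i)) \<partial>lebesgue)"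
    by (simp add: mass_def)
  also have "\<dots> \<le> s Q"
    unfolding s_def mass_def using exponent_pos sum_exponents by (intro Holder_prod) auto
  finally show ?thesis .
qed

lemma sigma_finite_weights:
  "sigma_finite_measure (weight_measure \<omega>)" "sigma_finite_measure (weight_measure (\<sigma> i))"
  "sigma_finite_measure (weight_measure \<nu>)"
  using mass_cube_finite weight_\<omega> weight_\<sigma> order_le_less_trans[OF mass_\<nu>_le_s s_cube_finite]
  by (auto intro!: sigma_finite_weight_measure)

text \<open>The split \<open>p = p / conjugate_exponent (ps i) + p / ps i\<close> separates the
  expression in \<open>A_const\<close> from \<open>s Q\<close>; since the exponents
  \<open>p / ps i\<close> add up to 1, exactly one factor \<open>emeasure lebesgue Q\<close>
  arises.\<close>

lemma mass_averages_eq: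
  assumes "Q \<in> cubes"
  shows "mass \<omega> E * (\<Prod>i\<in>UNIV. average (\<sigma> i) Q) epowr p =
    mass \<omega> E / emeasure lebesgue Q * (\<Prod>i\<in>UNIV. average (\<sigma> i) Q epowr (p / conjugate_exponent (ps i))) * s Q"
proof -
  have p_split: "p = p / conjugate_exponent (ps i) + p / ps i" "0 < p / conjugate_exponent (ps i)" for i
    using ps[of i] p by (auto simp: conjugate_exponent_def field_simps)
  have s: "s Q = (\<Prod>i\<in>UNIV. average (\<sigma> i) Q epowr (p / ps i)) * emeasure lebesgue Q"
  proof -
    have "s Q = (\<Prod>i\<in>UNIV. average (\<sigma> i) Q epowr (p / ps i) * emeasure lebesgue Q epowr (p / ps i))"
      unfolding s_def using assms by (simp add: average_mult_measure flip: epowr_mult)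
    then show ?thesis
      using epowr_sum[of UNIV "\<lambda>i. p / ps i" "emeasure lebesgue Q"] exponent_pos
      by (simp add: prod.distrib sum_exponents)
  qed
  have avgs: "(\<Prod>i\<in>UNIV. average (\<sigma> i) Q) epowr p =
      (\<Prod>i\<in>UNIV. average (\<sigma> i) Q epowr (p / conjugate_exponent (ps i)) * average (\<sigma> i) Q epowr (p / ps i))"
    unfolding epowr_prod
    by (intro prod.cong refl) (subst epowr_add[symmetric], auto simp: p_split exponent_pos simp flip: p_split(1))
  have "mass \<omega> E / emeasure lebesgue Q * emeasure lebesgue Q = mass \<omega> E"
    using emeasure_cube_nontrivial[OF assms] by (simp add: ennreal_divide_times less_top)
  then have "mass \<omega> E * (\<Prod>i\<in>UNIV. average (\<sigma> i) Q) epowr p =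
      mass \<omega> E / emeasure lebesgue Q * emeasure lebesgue Q * (\<Prod>i\<in>UNIV. average (\<sigma> i) Q) epowr p"
    by simp
  then show ?thesis
    by (simp only: avgs s prod.distrib ac_simps)
qed

lemma mass_averages_le_A_const:
  assumes "Q \<in> cubes" "E \<subseteq> Q"
  shows "mass \<omega> E * (\<Prod>i\<in>UNIV. average (\<sigma> i) Q) epowr p \<le> A_const p ps \<omega> \<sigma> * s Q"
proof -
  have "mass \<omega> E / emeasure lebesgue Q \<le> average \<omega> Q"
    unfolding average_def by (intro divide_right_mono_ennreal mass_mono assms)
  then have "mass \<omega> E / emeasure lebesgue Q *
      (\<Prod>i\<in>UNIV. average (\<sigma> i) Q epowr (p / conjugate_exponent (ps i))) \<le> A_const p ps \<omega> \<sigma>"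
    unfolding A_const_def using assms by (intro SUP_upper2[of Q] mult_right_mono) auto
  then show ?thesis
    unfolding mass_averages_eq[OF assms(1)] by (rule mult_right_mono) simp
qed

text \<open>Covers the cubes with \<open>s Q = 0\<close>, for which the testing inequality has
  right-hand side 0 whatever the constant.\<close>

lemma maximal_eq_0:
  assumes [measurable]: "Q \<in> sets lebesgue" and "mass (\<sigma> i) Q = 0"
  shows "\<M> (\<lambda>i y. \<sigma> i y * indicator Q y) x = 0"
proof -
  have "average (\<lambda>y. \<bar>\<sigma> i y * indicator Q y\<bar>) R = 0" for R
  proof -
    have "mass (\<lambda>y. \<bar>\<sigma> i y * indicator Q y\<bar>) R \<le> mass (\<sigma> i) Q"
      unfolding mass_def using weight_nonneg[OF weight_\<sigma>]
      by (intro nn_integral_mono) (auto simp: indicator_def)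
    with assms show ?thesis
      by (simp add: average_def)
  qed
  then have "(\<Prod>j\<in>UNIV. average (\<lambda>y. \<bar>\<sigma> j y * indicator Q y\<bar>) R) = 0" for R
    by (auto simp: prod_zero_iff)
  then show ?thesis
    by (simp add: multilinear_maximal_def flip: bot_ennreal)
qed

lemma parent_testing_const_le:
  assumes "Q \<in> parent_doubling_cubes \<sigma> \<rho> D"
  shows "(\<integral>\<^sup>+x\<in>Q. \<M> (\<lambda>i y. \<sigma> i y * indicator Q y) x epowr p * ennreal (\<omega> x) \<partial>lebesgue)
    \<le> parent_testing_const p ps \<rho> D \<omega> \<sigma> * s Q"
proof -
  \<comment> \<open>The constant \<open>top\<close> is admissible, so the infimum is taken over a
    nonempty set; where \<open>s R = 0\<close>, the left-hand side vanishes too.\<close>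
  have "(\<integral>\<^sup>+x\<in>R. \<M> (\<lambda>i y. \<sigma> i y * indicator R y) x epowr p * ennreal (\<omega> x) \<partial>lebesgue) \<le> top * s R"
    if "R \<in> cubes" for R
  proof (cases "s R = 0")
    case True
    then obtain i where "mass (\<sigma> i) R = 0"
      by (auto simp: s_eq_0_iff)
    with that show ?thesis by (simp add: maximal_eq_0)
  qed (simp add: ennreal_top_mult)
  then have "top \<in> {C. \<forall>Q\<in>parent_doubling_cubes \<sigma> \<rho> D.
        (\<integral>\<^sup>+x\<in>Q. \<M> (\<lambda>i y. \<sigma> i y * indicator Q y) x epowr p * ennreal (\<omega> x) \<partial>lebesgue) \<le> C * s Q}"
    by (auto simp: parent_doubling_cubes_def)
  moreover have "Q \<in> cubes"
    using assms by (simp add: parent_doubling_cubes_def)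
  ultimately show ?thesis
    unfolding parent_testing_const_def s_def[symmetric] using assms
    by (intro le_Inf_mult s_cube_finite) auto
qed

lemma s_le_RH_const:
  assumes "RH p ps \<sigma>" "Q \<in> cubes"
  shows "s Q \<le> RH_const p ps \<sigma> * mass \<nu> Q"
proof -
  have "mass \<nu> Q < top"
    using mass_\<nu>_le_s[of Q] s_cube_finite[of Q] assms by (auto intro: order_le_less_trans)
  then show ?thesis
    using assms unfolding RH_const_def RH_def RH_bound_def s_def[symmetric] \<nu>_def[symmetric]
    by (intro le_Inf_mult) auto
qed

section \<open>The necessary conditions\<close>

text \<open>Both bounds come from \<open>f i = indicator Q\<close>. On \<open>Q\<close> the maximal
  function is at least the product of the averages over \<open>Q\<close>, which turns the testing
  bound into the \<open>A\<close> bound.\<close>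

lemma
  assumes bound: "\<And>f. (\<And>i. f i \<in> Lspace (ps i) (\<sigma> i)) \<Longrightarrow>
        Lnorm p \<omega> (\<M> (\<lambda>i y. f i y * \<sigma> i y)) epowr p
          \<le> C * (\<Prod>i\<in>UNIV. Lnorm (ps i) (\<sigma> i) (\<lambda>x. ennreal \<bar>f i x\<bar>) epowr p)"
    and Q: "Q \<in> cubes"
  shows testing_of_bound: "(\<integral>\<^sup>+x\<in>Q. \<M> (\<lambda>i y. \<sigma> i y * indicator Q y) x epowr p * ennreal (\<omega> x) \<partial>lebesgue) \<le> C * s Q"
    and A_of_bound: "average \<omega> Q * (\<Prod>i\<in>UNIV. average (\<sigma> i) Q epowr (p / conjugate_exponent (ps i))) \<le> C"
proof -
  note [measurable] = cube_sets[OF Q]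
  define g where "g = \<M> (\<lambda>i y. \<sigma> i y * indicator Q y)"
  have [measurable]: "g \<in> borel_measurable lebesgue"
    unfolding g_def by (intro measurable_completion) simp
  have Lnorm: "Lnorm (ps i) (\<sigma> i) (\<lambda>x. ennreal \<bar>indicator Q x\<bar>) = mass (\<sigma> i) Q epowr (1 / ps i)" for i
  proof -
    have "(\<integral>\<^sup>+x. ennreal \<bar>indicator Q x\<bar> epowr ps i \<partial>weight_measure (\<sigma> i)) =
        (\<integral>\<^sup>+x. indicator Q x \<partial>weight_measure (\<sigma> i))"
      by (intro nn_integral_cong) (auto simp: indicator_def)
    then show ?thesis
      by (simp add: Lnorm_def emeasure_weight_measure)
  qed
  have "indicator Q \<in> Lspace (ps i) (\<sigma> i)" for i
    using mass_cube_finite[OF weight_\<sigma> Q, of i] by (simp add: Lspace_def Lnorm[simplified])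
  then have "Lnorm p \<omega> (\<M> (\<lambda>i y. indicator Q y * \<sigma> i y)) epowr p
      \<le> C * (\<Prod>i\<in>UNIV. Lnorm (ps i) (\<sigma> i) (\<lambda>x. ennreal \<bar>indicator Q x\<bar>) epowr p)"
    by (intro bound)
  then have "(\<integral>\<^sup>+x. g x epowr p \<partial>weight_measure \<omega>) \<le> C * s Q"
    using p by (simp add: Lnorm_powr Lnorm[simplified] g_def s_def epowr_epowr mult.commute[of "indicator Q _"])
  then have "(\<integral>\<^sup>+x. ennreal (\<omega> x) * g x epowr p \<partial>lebesgue) \<le> C * s Q"
    by (subst (asm) nn_integral_weight_measure) measurable
  moreover have "(\<integral>\<^sup>+x\<in>Q. g x epowr p * ennreal (\<omega> x) \<partial>lebesgue) \<le> (\<integral>\<^sup>+x. ennreal (\<omega> x) * g x epowr p \<partial>lebesgue)"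
    by (intro nn_integral_mono) (auto simp: indicator_def mult.commute)
  ultimately have testing: "(\<integral>\<^sup>+x\<in>Q. g x epowr p * ennreal (\<omega> x) \<partial>lebesgue) \<le> C * s Q"
    by simp
  then show "(\<integral>\<^sup>+x\<in>Q. \<M> (\<lambda>i y. \<sigma> i y * indicator Q y) x epowr p * ennreal (\<omega> x) \<partial>lebesgue) \<le> C * s Q"
    by (simp add: g_def)
  let ?T = "average \<omega> Q * (\<Prod>i\<in>UNIV. average (\<sigma> i) Q epowr (p / conjugate_exponent (ps i)))"
  show "?T \<le> C"
  \<comment> \<open>The argument divides by \<open>s Q\<close>; if \<open>s Q\<close> is 0, one of
    the averages in \<open>?T\<close> vanishes.\<close>
  proof (cases "s Q = 0")
    case True
    then obtain i where "mass (\<sigma> i) Q = 0"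
      by (auto simp: s_eq_0_iff)
    then have "(\<Prod>i\<in>UNIV. average (\<sigma> i) Q epowr (p / conjugate_exponent (ps i))) = 0"
      by (auto simp: prod_zero_iff average_def)
    then show ?thesis by (simp only: mult_zero_right zero_le)
  next
    case False
    define a where "a = (\<Prod>i\<in>UNIV. average (\<sigma> i) Q) epowr p"
    have "a \<le> g x epowr p" if "x \<in> Q" for x
    proof -
      have "average (\<lambda>y. \<bar>\<sigma> i y * indicator Q y\<bar>) Q = average (\<sigma> i) Q" for i
        unfolding average_def using weight_nonneg[OF weight_\<sigma>] by (subst mass_cong[of Q _ "\<sigma> i"]) auto
      then show ?thesis
        using maximal_ge[OF Q that, of "\<lambda>i y. \<sigma> i y * indicator Q y"] p
        by (auto simp: g_def a_def intro!: epowr_mono)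
    qed
    then have "(\<integral>\<^sup>+x. a * (ennreal (\<omega> x) * indicator Q x) \<partial>lebesgue)
        \<le> (\<integral>\<^sup>+x\<in>Q. g x epowr p * ennreal (\<omega> x) \<partial>lebesgue)"
      by (intro nn_integral_mono) (auto simp: indicator_def intro: mult_right_mono)
    also note testing
    also have "(\<integral>\<^sup>+x. a * (ennreal (\<omega> x) * indicator Q x) \<partial>lebesgue) = mass \<omega> Q * a"
      unfolding mass_def by (subst nn_integral_cmult) (auto simp: mult.commute)
    also have "mass \<omega> Q * a = ?T * s Q"
      unfolding a_def mass_averages_eq[OF Q] by (simp add: average_def)
    finally have "?T * s Q / s Q \<le> C * s Q / s Q"
      by (rule divide_right_mono_ennreal)
    then show ?thesis
      using False s_cube_finite[OF Q] by (simp add: ennreal_mult_divide_eq less_top)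
  qed
qed

text \<open>Each summand is bounded separately, whence the factor 2. The testing bound holds on all
  cubes, so \<open>\<rho>\<close> and \<open>D\<close> are arbitrary here.\<close>

lemma A_plus_testing_le_N_const:
  "A_const p ps \<omega> \<sigma> + parent_testing_const p ps \<rho> D \<omega> \<sigma> \<le> 2 * N_const p ps \<omega> \<sigma>"
proof -
  have "A_const p ps \<omega> \<sigma> \<le> N_const p ps \<omega> \<sigma>"
    unfolding N_const_def A_const_def by (intro Inf_greatest SUP_least A_of_bound) auto
  moreover have "parent_testing_const p ps \<rho> D \<omega> \<sigma> \<le> N_const p ps \<omega> \<sigma>"
    unfolding N_const_def parent_testing_const_def s_def[symmetric]
    by (rule Inf_superset_mono) (auto simp: parent_doubling_cubes_def intro!: testing_of_bound)
  ultimately show ?thesis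
    by (simp add: mult_2 add_mono)
qed

end

section \<open>Packing from testing on parent doubling cells\<close>

lemma sum_disjoint_indicator_le:
  fixes a :: "'i \<Rightarrow> ennreal"
  assumes "finite F" "disjoint_family_on E F" "\<And>q. q \<in> F \<Longrightarrow> x \<in> E q \<Longrightarrow> a q \<le> b"
  shows "(\<Sum>q\<in>F. a q * indicator (E q) x) \<le> b"
proof (cases "\<exists>q\<in>F. x \<in> E q")
  case True
  then obtain r where r: "r \<in> F" "x \<in> E r" by blast
  then have "x \<notin> E q" if "q \<in> F" "q \<noteq> r" for q
    using assms(2) that by (auto simp: disjoint_family_on_def)
  then have "(\<Sum>q\<in>F. a q * indicator (E q) x) = (\<Sum>q\<in>F. if q = r then a r else 0)"
    using r by (intro sum.cong) (auto simp: indicator_def)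
  also have "\<dots> \<le> b"
    using r assms by simp
  finally show ?thesis .
next
  case False
  then have "(\<Sum>q\<in>F. a q * indicator (E q) x) = 0"
    by (intro sum.neutral) auto
  then show ?thesis by simp
qed

section \<open>Comparison of \<open>\<M>\<close> with the maximal operators of the shifted
  grids\<close>

context nadic_grid
begin

text \<open>Averages are taken over closed cells, as in \<open>\<M>\<close>, but assigned to the
  points of half-open cells, which form a laminar family.\<close>

definition grid_maximal :: "('m::finite \<Rightarrow> real ^ 'd \<Rightarrow> real) \<Rightarrow> real ^ 'd \<Rightarrow> ennreal" where
  "grid_maximal f x = (SUP q. (\<Prod>i\<in>UNIV. average (\<lambda>y. \<bar>f i y\<bar>) (closed_cell q)) * indicator (cell q) x)"

lemma borel_measurable_grid_maximal [measurable]: "grid_maximal f \<in> borel_measurable lebesgue"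
  unfolding grid_maximal_def by (intro borel_measurable_SUP) auto

end

text \<open>Every cube lies in a cell of some shifted grid whose volume is at most
  \<open>(real N ^ 2) ^ CARD('d)\<close> times as large; this factor is lost once for each of the
  \<open>CARD('m)\<close> averages.\<close>

lemma maximal_le_grid_maximal:
  fixes f :: "'m::finite \<Rightarrow> real ^ 'd \<Rightarrow> real"
  assumes N: "3 \<le> N"
  shows "\<M> f x \<le> ennreal (((real N ^ 2) ^ CARD('d)) ^ CARD('m)) * (SUP S. nadic_grid.grid_maximal N S f x)"
  unfolding multilinear_maximal_def
proof (rule SUP_least)
  fix Q assume "Q \<in> {Q \<in> cubes. x \<in> Q}"
  then have Q: "Q \<in> cubes" "x \<in> Q" by auto
  obtain S q where sub: "Q \<subseteq> nadic_grid.cell N S q"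
    and len: "nadic_grid.len N q ^ CARD('d) \<le> (real N ^ 2) ^ CARD('d) * measure lebesgue Q"
    using cube_subset_cell[OF N Q(1)] by blast
  interpret nadic_grid N S
    by standard (rule N)
  define B where "B = (real N ^ 2) ^ CARD('d)"
  define v where "v = measure lebesgue Q"
  have v: "emeasure lebesgue Q = ennreal v" "0 < v"
    using emeasure_cube_nontrivial[OF Q(1)] emeasure_eq_ennreal_measure[of lebesgue Q]
    by (auto simp: v_def order_less_le)
  have "1 / v \<le> B * (1 / len q ^ CARD('d))"
    using len v(2) by (simp add: B_def v_def field_simps)
  then have B: "ennreal (1 / v) \<le> ennreal B * ennreal (1 / len q ^ CARD('d))"
    by (subst ennreal_mult[symmetric]) (auto simp: B_def intro!: ennreal_leI)
  have "average (\<lambda>y. \<bar>f i y\<bar>) Q \<le> ennreal B * average (\<lambda>y. \<bar>f i y\<bar>) (closed_cell q)" for i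
  proof -
    have "average (\<lambda>y. \<bar>f i y\<bar>) Q = mass (\<lambda>y. \<bar>f i y\<bar>) Q * ennreal (1 / v)"
      using v by (simp add: average_def divide_ennreal_def inverse_ennreal inverse_eq_divide)
    also have "\<dots> \<le> mass (\<lambda>y. \<bar>f i y\<bar>) (closed_cell q) * (ennreal B * ennreal (1 / len q ^ CARD('d)))"
      using sub cell_subset_closed_cell[of q] by (intro mult_mono B mass_mono) auto
    also have "\<dots> = ennreal B * average (\<lambda>y. \<bar>f i y\<bar>) (closed_cell q)"
      by (simp add: average_def emeasure_closed_cell divide_ennreal_def inverse_ennreal inverse_eq_divide ac_simps)
    finally show ?thesis .
  qed
  then have "(\<Prod>i\<in>UNIV. average (\<lambda>y. \<bar>f i y\<bar>) Q)
      \<le> (\<Prod>i\<in>UNIV. ennreal B * average (\<lambda>y. \<bar>f i y\<bar>) (closed_cell q))"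
    by (intro prod_mono_ennreal)
  also have "\<dots> = ennreal (B ^ CARD('m)) * (\<Prod>i\<in>UNIV. average (\<lambda>y. \<bar>f i y\<bar>) (closed_cell q))"
    by (simp add: prod.distrib ennreal_power B_def)
  also have "\<dots> \<le> ennreal (B ^ CARD('m)) * (SUP S. nadic_grid.grid_maximal N S f x)"
  proof (intro mult_left_mono SUP_upper2[of S])
    show "(\<Prod>i\<in>UNIV. average (\<lambda>y. \<bar>f i y\<bar>) (closed_cell q)) \<le> grid_maximal f x"
      unfolding grid_maximal_def using sub Q(2) by (intro SUP_upper2[of q]) auto
  qed auto
  finally show "(\<Prod>i\<in>UNIV. average (\<lambda>y. \<bar>f i y\<bar>) Q)
      \<le> ennreal (((real N ^ 2) ^ CARD('d)) ^ CARD('m)) * (SUP S. nadic_grid.grid_maximal N S f x)"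
    by (simp add: B_def)
qed

text \<open>The constants of \<open>laminar_maximal_inequality\<close> for the exponents
  \<open>ps i\<close>, with the powers they receive from Hoelder's inequality.\<close>

definition maximal_const :: "('m::finite \<Rightarrow> real) \<Rightarrow> real \<Rightarrow> ennreal" where
  "maximal_const ps p = (\<Prod>i\<in>UNIV. ennreal (2 powr ps i * (ps i / (ps i - 1))) epowr (p / ps i))"

lemma maximal_const_finite: "maximal_const ps p < top"
  unfolding maximal_const_def less_top[symmetric] ennreal_prod_eq_top by simp

text \<open>The bound \<open>\<rho> \<le> real N\<close> makes the grid parent of a cell long enough
  to serve as the cube \<open>P\<close> in the definition of parent doubling.\<close>

locale grid_weights = nadic_grid N S + weight_tuple ps p \<omega> \<sigma>
  for N :: nat and S :: "'d::finite set" and ps :: "'m::finite \<Rightarrow> real" and p :: real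
    and \<omega> :: "real ^ 'd \<Rightarrow> real" and \<sigma> :: "'m \<Rightarrow> real ^ 'd \<Rightarrow> real" +
  fixes \<rho> :: real
  assumes \<rho>_le_N: "\<rho> \<le> real N" and RH: "RH p ps \<sigma>"
begin

text \<open>Twice the bound in \<open>card_children\<close> on the number of children of a
  cell.\<close>

definition D :: real where
  "D = 2 * real N ^ CARD('d)"

definition K :: ennreal where
  "K = A_const p ps \<omega> \<sigma> + parent_testing_const p ps \<rho> D \<omega> \<sigma>"

lemma D_pos: "0 < D"
  by (simp add: D_def)

lemma cell_sets' [measurable]: "cell q \<in> sets lebesgue" "closed_cell q \<in> sets lebesgue"
  using cell_sets cube_sets[OF closed_cell_mem_cubes] by blast+

text \<open>The parent cell fails as a witness of doubling for every \<open>i\<close>, so each of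
  its masses is at least \<open>D\<close> times that of the child. As the exponents
  \<open>p / ps i\<close> add up to 1, the same holds for \<open>s\<close>.\<close>

lemma s_le_of_not_doubling:
  assumes "closed_cell c \<notin> parent_doubling_cubes \<sigma> \<rho> D"
  shows "s (closed_cell c) \<le> s (closed_cell (up c)) * ennreal (1 / D)"
proof -
  have "ennreal D * mass (\<sigma> i) (closed_cell c) \<le> mass (\<sigma> i) (closed_cell (up c))" for i
  proof (rule ccontr)
    assume "\<not> ?thesis"
    then have "mass (\<sigma> i) (closed_cell (up c)) \<le> ennreal D * mass (\<sigma> i) (closed_cell c)"
      by simp
    moreover have "\<rho> * side_length (closed_cell c) \<le> side_length (closed_cell (up c))"
      using \<rho>_le_N by (simp add: side_length_closed_cell len_up)
    ultimately show False
      using assms closed_cell_mem_cubes closed_cell_mono[OF cell_subset_up[of c]]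
      by (auto simp: parent_doubling_cubes_def)
  qed
  then have "(\<Prod>i\<in>UNIV. (ennreal D * mass (\<sigma> i) (closed_cell c)) epowr (p / ps i)) \<le> s (closed_cell (up c))"
    unfolding s_def using exponent_pos by (intro prod_mono_ennreal epowr_mono) (auto simp: less_imp_le)
  also have "(\<Prod>i\<in>UNIV. (ennreal D * mass (\<sigma> i) (closed_cell c)) epowr (p / ps i)) = ennreal D * s (closed_cell c)"
    using epowr_sum[of UNIV "\<lambda>i. p / ps i" "ennreal D"] exponent_pos
    by (simp add: s_def epowr_mult prod.distrib sum_exponents)
  finally have "ennreal (1 / D) * (ennreal D * s (closed_cell c)) \<le> ennreal (1 / D) * s (closed_cell (up c))"
    by (rule mult_left_mono) simp
  moreover have "ennreal (1 / D) * ennreal D = 1"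
    using D_pos by (simp flip: ennreal_mult)
  ultimately show ?thesis
    by (simp add: mult.assoc[symmetric] mult.commute[of "ennreal (1 / D)"])
qed

text \<open>Hoelder's inequality for sums reduces this to the additivity of the masses over the
  disjoint children.\<close>

lemma sum_s_children_le: "(\<Sum>c\<in>{c. up c = r}. s (closed_cell c)) \<le> s (closed_cell r)"
proof -
  have "(\<Sum>c\<in>{c. up c = r}. s (closed_cell c))
      \<le> (\<Prod>i\<in>UNIV. (\<Sum>c\<in>{c. up c = r}. mass (\<sigma> i) (closed_cell c)) epowr (p / ps i))"
    unfolding s_def using exponent_pos sum_exponents finite_children by (intro Holder_sum) auto
  also have "\<dots> \<le> s (closed_cell r)"
    unfolding s_def
  proof (intro prod_mono_ennreal epowr_mono)
    fix i
    have "disjoint_family_on cell {c. up c = r}"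
      unfolding disjoint_family_on_def
    proof (intro ballI impI)
      fix c c' assume c: "c \<in> {c. up c = r}" "c' \<in> {c. up c = r}" "c \<noteq> c'"
      then have "fst c = fst c'"
        by (auto simp: up_def)
      with \<open>c \<noteq> c'\<close> show "cell c \<inter> cell c' = {}"
        using cell_nested[of _ c c'] cell_eqI[of c c'] by auto
    qed
    then have "(\<Sum>c\<in>{c. up c = r}. emeasure (weight_measure (\<sigma> i)) (cell c)) =
        emeasure (weight_measure (\<sigma> i)) (\<Union>c\<in>{c. up c = r}. cell c)"
      using finite_children by (intro sum_emeasure) auto
    also have "\<dots> \<le> emeasure (weight_measure (\<sigma> i)) (cell r)"
      using cell_subset_up by (intro emeasure_mono) auto
    finally show "(\<Sum>c\<in>{c. up c = r}. mass (\<sigma> i) (closed_cell c)) \<le> mass (\<sigma> i) (closed_cell r)"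
      by (simp add: emeasure_weight_measure mass_cell)
  qed (use exponent_pos in \<open>auto simp: less_imp_le\<close>)
  finally show ?thesis .
qed

context
  fixes F :: "(int \<times> (int ^ 'd)) set" and E
  assumes F: "finite F" and E: "\<And>q. q \<in> F \<Longrightarrow> E q \<in> sets lebesgue" "\<And>q. q \<in> F \<Longrightarrow> E q \<subseteq> cell q"
    "disjoint_family_on E F"
begin

text \<open>The part of a term of the linearized integral that does not involve the functions
  \<open>f i\<close>.\<close>

definition \<mu> :: "int \<times> (int ^ 'd) \<Rightarrow> ennreal" where
  "\<mu> q = mass \<omega> (E q) * (\<Prod>i\<in>UNIV. average (\<sigma> i) (closed_cell q)) epowr p"

text \<open>Cutting the weights off outside \<open>r\<close> does not affect averages over cells
  inside \<open>r\<close>, so on \<open>E q\<close> they are bounded by the tested maximal function.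
  The sets \<open>E q\<close> are disjoint, so at each point at most one term counts.\<close>

lemma sum_\<mu>_le_testing:
  assumes r: "closed_cell r \<in> parent_doubling_cubes \<sigma> \<rho> D"
  shows "(\<Sum>q\<in>{q\<in>F. cell q \<subseteq> cell r}. \<mu> q) \<le> parent_testing_const p ps \<rho> D \<omega> \<sigma> * s (closed_cell r)"
proof -
  define F' where "F' = {q\<in>F. cell q \<subseteq> cell r}"
  define a where "a q = (\<Prod>i\<in>UNIV. average (\<sigma> i) (closed_cell q)) epowr p" for q
  define g where "g x = \<M> (\<lambda>i y. \<sigma> i y * indicator (closed_cell r) y) x epowr p" for x
  have [measurable]: "E q \<in> sets lebesgue" if "q \<in> F'" for q
    using that E by (simp add: F'_def)
  have a_le: "a q * ennreal (\<omega> x) \<le> g x * ennreal (\<omega> x) * indicator (closed_cell r) x" if "q \<in> F'" "x \<in> E q" for q x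
  proof -
    have x: "x \<in> closed_cell q"
      using E(2)[of q] that cell_subset_closed_cell[of q] by (auto simp: F'_def)
    have sub: "closed_cell q \<subseteq> closed_cell r"
      using that by (intro closed_cell_mono) (auto simp: F'_def)
    have "average (\<lambda>y. \<bar>\<sigma> i y * indicator (closed_cell r) y\<bar>) (closed_cell q) = average (\<sigma> i) (closed_cell q)" for i
      unfolding average_def using sub weight_nonneg[OF weight_\<sigma>]
      by (subst mass_cong[of "closed_cell q" _ "\<sigma> i"]) auto
    then have "a q \<le> g x"
      using maximal_ge[OF closed_cell_mem_cubes x, of "\<lambda>i y. \<sigma> i y * indicator (closed_cell r) y"] p
      by (auto simp: a_def g_def intro!: epowr_mono)
    then show ?thesis
      using x sub by (auto simp: indicator_def intro: mult_right_mono)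
  qed
  have "(\<Sum>q\<in>F'. \<mu> q) = (\<integral>\<^sup>+x. (\<Sum>q\<in>F'. a q * ennreal (\<omega> x) * indicator (E q) x) \<partial>lebesgue)"
  proof -
    have "\<mu> q = (\<integral>\<^sup>+x. a q * ennreal (\<omega> x) * indicator (E q) x \<partial>lebesgue)" if "q \<in> F'" for q
    proof -
      have [measurable]: "E q \<in> sets lebesgue"
        using that by measurable
      have "(\<integral>\<^sup>+x. a q * (ennreal (\<omega> x) * indicator (E q) x) \<partial>lebesgue) = a q * mass \<omega> (E q)"
        unfolding mass_def by (intro nn_integral_cmult) measurable
      then show ?thesis
        by (simp add: \<mu>_def a_def ac_simps)
    qed
    then show ?thesis
      by (subst nn_integral_sum) auto
  qed
  also have "\<dots> \<le> (\<integral>\<^sup>+x. g x * ennreal (\<omega> x) * indicator (closed_cell r) x \<partial>lebesgue)"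
    using F E(3) a_le by (intro nn_integral_mono sum_disjoint_indicator_le) (auto simp: F'_def disjoint_family_on_def)
  also have "\<dots> \<le> parent_testing_const p ps \<rho> D \<omega> \<sigma> * s (closed_cell r)"
    using parent_testing_const_le[OF r] by (simp add: g_def)
  finally show ?thesis
    by (simp add: F'_def)
qed

text \<open>
  Since a nondoubling child carries at most the fraction \<open>1 / D\<close> of \<open>s\<close> and there are at most \<open>D / 2\<close> children,
  the nondoubling children contribute at most half of the bound claimed.
\<close>

lemma sum_\<mu>_le_depth:
  "(\<Sum>q\<in>{q\<in>F. cell q \<subseteq> cell r \<and> fst q < fst r + int n}. \<mu> q) \<le> 2 * K * s (closed_cell r)"
proof (induction n arbitrary: r)
  case 0
  \<comment> \<open>A cell inside \<open>r\<close> has at least the level of \<open>r\<close>, so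
    depth 0 leaves none.\<close>
  have "\<not> (cell q \<subseteq> cell r \<and> fst q < fst r + int 0)" for q
    using level_mono[of q r] by auto
  then show ?case
    by (simp only: simp_thms empty_def[symmetric] sum.empty zero_le)
next
  case (Suc n)
  define B where "B n r = {q\<in>F. cell q \<subseteq> cell r \<and> fst q < fst r + int n}" for n r
  define P where "P = parent_testing_const p ps \<rho> D \<omega> \<sigma>"
  define ch where "ch = {c. up c = r}"
  have fin: "finite (B n r)" for n r
    using F by (simp add: B_def)
  have "finite ch"
    using finite_children by (simp add: ch_def)
  \<comment> \<open>The first summand bounds the doubling children and the second one the others;
    their sum serves every child, so the children need not be separated.\<close>
  have child: "(\<Sum>q\<in>B n c. \<mu> q) \<le> P * s (closed_cell c) + 2 * K * (s (closed_cell r) * ennreal (1 / D))"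
    if "c \<in> ch" for c
  proof (cases "closed_cell c \<in> parent_doubling_cubes \<sigma> \<rho> D")
    case True
    have "(\<Sum>q\<in>B n c. \<mu> q) \<le> (\<Sum>q\<in>{q\<in>F. cell q \<subseteq> cell c}. \<mu> q)"
      using F by (intro sum_mono2) (auto simp: B_def)
    also have "\<dots> \<le> P * s (closed_cell c)"
      unfolding P_def by (rule sum_\<mu>_le_testing[OF True])
    finally show ?thesis
      by (rule order_trans) simp
  next
    case False
    have "(\<Sum>q\<in>B n c. \<mu> q) \<le> 2 * K * s (closed_cell c)"
      using Suc by (simp add: B_def)
    also have "\<dots> \<le> 2 * K * (s (closed_cell r) * ennreal (1 / D))"
      using s_le_of_not_doubling[OF False] that by (intro mult_left_mono) (auto simp: ch_def)
    finally show ?thesis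
      by (rule order_trans) simp
  qed
  \<comment> \<open>A member below \<open>r\<close> is \<open>r\<close> itself or lies below a child
    of \<open>r\<close>, relative to which the depth bound drops by one.\<close>
  have sub: "B (Suc n) r \<subseteq> ({r} \<inter> F) \<union> (\<Union>c\<in>ch. B n c)"
  proof
    fix q assume q: "q \<in> B (Suc n) r"
    show "q \<in> ({r} \<inter> F) \<union> (\<Union>c\<in>ch. B n c)"
    proof (cases "fst q = fst r")
      case True
      then show ?thesis
        using q cell_eqI by (auto simp: B_def)
    next
      case False
      then have "fst r < fst q"
        using q level_mono[of q r] by (auto simp: B_def)
      with q obtain c where "up c = r" "cell q \<subseteq> cell c" "fst c = fst r + 1"
        using cell_subset_child[of q r] by (auto simp: B_def)
      with q have "q \<in> B n c" "c \<in> ch"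
        by (simp_all add: B_def ch_def)
      then show ?thesis by blast
    qed
  qed
  have root: "(\<Sum>q\<in>{r} \<inter> F. \<mu> q) \<le> A_const p ps \<omega> \<sigma> * s (closed_cell r)"
  proof (cases "r \<in> F")
    case True
    then have "E r \<subseteq> closed_cell r"
      using E(2)[of r] cell_subset_closed_cell[of r] by blast
    with True show ?thesis
      using mass_averages_le_A_const[OF closed_cell_mem_cubes, of "E r" r] by (simp add: \<mu>_def)
  qed simp
  \<comment> \<open>This uses that there are at most \<open>D / 2\<close> children.\<close>
  have half: "of_nat (card ch) * (2 * K * (s (closed_cell r) * ennreal (1 / D))) \<le> K * s (closed_cell r)"
  proof -
    have "of_nat (card ch) * 2 * ennreal (1 / D) \<le> of_nat (N ^ CARD('d)) * 2 * ennreal (1 / D)"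
      using card_children[of r] unfolding ch_def by (intro mult_right_mono) (auto simp del: of_nat_power)
    also have "\<dots> = 1"
    proof -
      have "of_nat (N ^ CARD('d)) * 2 = ennreal D"
        using ennreal_of_nat_eq_real_of_nat[of "2 * N ^ CARD('d)"] by (simp add: D_def mult.commute)
      then show ?thesis
        using D_pos by (simp flip: ennreal_mult)
    qed
    finally have "of_nat (card ch) * 2 * ennreal (1 / D) \<le> 1" .
    from mult_right_mono[OF this, of "K * s (closed_cell r)"] show ?thesis
      by (simp add: ac_simps)
  qed
  have "(\<Sum>q\<in>B (Suc n) r. \<mu> q) \<le> (\<Sum>q\<in>({r} \<inter> F) \<union> (\<Union>c\<in>ch. B n c). \<mu> q)"
    using sub F fin \<open>finite ch\<close> by (intro sum_mono2) auto
  also have "\<dots> \<le> (\<Sum>q\<in>{r} \<inter> F. \<mu> q) + (\<Sum>q\<in>(\<Union>c\<in>ch. B n c). \<mu> q)"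
    using fin \<open>finite ch\<close> by (subst sum.union_inter[symmetric]) auto
  also have "\<dots> \<le> A_const p ps \<omega> \<sigma> * s (closed_cell r) + (\<Sum>c\<in>ch. \<Sum>q\<in>B n c. \<mu> q)"
    using fin \<open>finite ch\<close> by (intro add_mono root sum_UNION_le) auto
  also have "(\<Sum>c\<in>ch. \<Sum>q\<in>B n c. \<mu> q) \<le>
      (\<Sum>c\<in>ch. P * s (closed_cell c) + 2 * K * (s (closed_cell r) * ennreal (1 / D)))"
    by (intro sum_mono child)
  also have "\<dots> = P * (\<Sum>c\<in>ch. s (closed_cell c)) + of_nat (card ch) * (2 * K * (s (closed_cell r) * ennreal (1 / D)))"
    by (simp add: sum.distrib sum_distrib_left)
  also have "\<dots> \<le> P * s (closed_cell r) + K * s (closed_cell r)"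
    unfolding ch_def by (intro add_mono mult_left_mono sum_s_children_le half[unfolded ch_def]) auto
  \<comment> \<open>The contributions of the root, of the doubling children and of the others have
    the constants \<open>A_const p ps \<omega> \<sigma>\<close>, \<open>P\<close> and
    \<open>K\<close>, which add up to \<open>2 * K\<close>.\<close>
  finally show ?case
    by (simp add: B_def K_def P_def distrib_right mult_2 add_ac add_left_mono)
qed

lemma sum_\<mu>_le:
  "(\<Sum>q\<in>{q\<in>F. cell q \<subseteq> cell r}. \<mu> q)
    \<le> 2 * K * RH_const p ps \<sigma> * emeasure (weight_measure \<nu>) (cell r)"
proof -
  \<comment> \<open>An upper bound for the depth of the finite family; \<open>insert 0\<close> keeps
    \<open>Max\<close> meaningful for empty \<open>F\<close>.\<close>
  define n where "n = Suc (Max (insert 0 ((\<lambda>q. nat (fst q - fst r)) ` F)))"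
  have "fst q < fst r + int n" if "q \<in> F" for q
  proof -
    have "nat (fst q - fst r) < n"
      using F that by (auto simp: n_def less_Suc_eq_le)
    then show ?thesis by linarith
  qed
  then have "{q\<in>F. cell q \<subseteq> cell r} = {q\<in>F. cell q \<subseteq> cell r \<and> fst q < fst r + int n}"
    by auto
  then have "(\<Sum>q\<in>{q\<in>F. cell q \<subseteq> cell r}. \<mu> q) \<le> 2 * K * s (closed_cell r)"
    using sum_\<mu>_le_depth by simp
  \<comment> \<open>The reverse Hoelder condition is used here, to pass from \<open>s\<close> to a
    measure.\<close>
  also have "\<dots> \<le> 2 * K * (RH_const p ps \<sigma> * mass \<nu> (closed_cell r))"
    using RH closed_cell_mem_cubes by (intro mult_left_mono s_le_RH_const) auto
  finally show ?thesis
    by (simp add: emeasure_weight_measure mass_cell mult.assoc)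
qed

end

section \<open>The maximal operator of a grid\<close>

lemma grid_maximal_bound_finite:
  assumes F: "finite F" and f: "\<And>i. f i \<in> borel_measurable lebesgue"
  shows "(\<integral>\<^sup>+x. (SUP q\<in>F. (\<Prod>i\<in>UNIV. average (\<lambda>y. \<bar>f i y * \<sigma> i y\<bar>) (closed_cell q)) * indicator (cell q) x) epowr p
      \<partial>weight_measure \<omega>)
    \<le> 2 * K * RH_const p ps \<sigma> *
      (maximal_const ps p * (\<Prod>i\<in>UNIV. (\<integral>\<^sup>+x. ennreal \<bar>f i x\<bar> epowr ps i \<partial>weight_measure (\<sigma> i)) epowr (p / ps i)))"
proof -
  note [measurable] = f
  define avg where "avg q = (\<Prod>i\<in>UNIV. average (\<lambda>y. \<bar>f i y * \<sigma> i y\<bar>) (closed_cell q))" for q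
  \<comment> \<open>The average of \<open>\<bar>f i y\<bar>\<close> with respect to
    \<open>\<sigma> i\<close>; the Lebesgue average of \<open>f i y * \<sigma> i y\<close> in
    absolute value is this times the average of \<open>\<sigma> i\<close>.\<close>
  define b where "b i q = (\<integral>\<^sup>+y\<in>cell q. ennreal \<bar>f i y\<bar> \<partial>weight_measure (\<sigma> i)) /
      emeasure (weight_measure (\<sigma> i)) (cell q)" for i q
  define c where "c q = (\<Prod>i\<in>UNIV. b i q) epowr p" for q
  define T where "T i x = (SUP q\<in>F. b i q * indicator (cell q) x)" for i x
  have [measurable]: "T i \<in> borel_measurable lebesgue" for i
    unfolding T_def using F by (intro borel_measurable_SUP) (auto simp: countable_finite)
  have avg: "avg q = (\<Prod>i\<in>UNIV. average (\<sigma> i) (closed_cell q)) * (\<Prod>i\<in>UNIV. b i q)" for q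
  proof -
    have "average (\<lambda>y. \<bar>f i y * \<sigma> i y\<bar>) (closed_cell q) = average (\<sigma> i) (closed_cell q) * b i q" for i
    proof -
      define I where "I = (\<integral>\<^sup>+y\<in>cell q. ennreal \<bar>f i y\<bar> \<partial>weight_measure (\<sigma> i))"
      have "I = (\<integral>\<^sup>+y. ennreal (\<sigma> i y) * (ennreal \<bar>f i y\<bar> * indicator (cell q) y) \<partial>lebesgue)"
        unfolding I_def by (intro nn_integral_weight_measure) measurable
      also have "\<dots> = mass (\<lambda>y. \<bar>f i y * \<sigma> i y\<bar>) (cell q)"
        unfolding mass_def using weight_nonneg[OF weight_\<sigma>]
        by (intro nn_integral_cong) (simp add: abs_mult ennreal_mult ac_simps)
      finally have I: "mass (\<lambda>y. \<bar>f i y * \<sigma> i y\<bar>) (closed_cell q) = I"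
        by (simp add: mass_cell)
      define m where "m = mass (\<sigma> i) (closed_cell q)"
      have m: "emeasure (weight_measure (\<sigma> i)) (cell q) = m"
        by (simp add: emeasure_weight_measure mass_cell m_def)
      have "m < top"
        unfolding m_def by (intro mass_cube_finite weight_\<sigma> closed_cell_mem_cubes)
      \<comment> \<open>For \<open>m = 0\<close> both sides vanish, because the cell is then a null
        set of \<open>weight_measure (\<sigma> i)\<close>.\<close>
      have "I = m * (I / m)"
      proof (cases "m = 0")
        case True
        then have "AE y in weight_measure (\<sigma> i). y \<notin> cell q"
          using m by (intro AE_not_in) (auto simp: null_sets_def)
        then have "I = (\<integral>\<^sup>+y. 0 \<partial>weight_measure (\<sigma> i))"
          unfolding I_def by (intro nn_integral_cong_AE) (auto elim!: eventually_mono)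
        then show ?thesis using True by simp
      next
        case False
        with \<open>m < top\<close> show ?thesis
          by (simp add: ennreal_times_divide mult.commute[of m] ennreal_mult_divide_eq)
      qed
      then show ?thesis
        unfolding average_def b_def I m I_def[symmetric] m_def[symmetric] ennreal_divide_times
        by (simp add: ennreal_times_divide ac_simps)
    qed
    then show ?thesis
      by (simp add: avg_def prod.distrib)
  qed
  \<comment> \<open>The supremum is linearized after taking \<open>p\<close>-th powers, so that the
    integral becomes a finite sum.\<close>
  obtain E where E: "\<And>q. q \<in> F \<Longrightarrow> E q \<in> sets lebesgue" "\<And>q. q \<in> F \<Longrightarrow> E q \<subseteq> cell q" "disjoint_family_on E F"
    and SUP_E: "\<And>x. (SUP q\<in>F. avg q epowr p * indicator (cell q) x) = (\<Sum>q\<in>F. avg q epowr p * indicator (E q) x)"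
    using SUP_indicator_disjoint[OF F, of cell lebesgue "\<lambda>q. avg q epowr p"] cell_sets by blast
  note [measurable] = E(1)
  have "(\<integral>\<^sup>+x. (SUP q\<in>F. avg q * indicator (cell q) x) epowr p \<partial>weight_measure \<omega>)
      = (\<integral>\<^sup>+x. (\<Sum>q\<in>F. avg q epowr p * indicator (E q) x) \<partial>weight_measure \<omega>)"
    using p by (simp add: epowr_SUP epowr_indicator SUP_E)
  also have "\<dots> = (\<Sum>q\<in>F. avg q epowr p * mass \<omega> (E q))"
    by (subst nn_integral_sum) (auto simp: nn_integral_cmult emeasure_weight_measure E(1) intro!: sum.cong)
  also have "\<dots> = (\<Sum>q\<in>F. \<mu> E q * c q)"
    using F E by (intro sum.cong refl) (simp add: avg \<mu>_def c_def epowr_mult ac_simps)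
  also have "\<dots> \<le> 2 * K * RH_const p ps \<sigma> * (\<integral>\<^sup>+x. (SUP q\<in>F. c q * indicator (cell q) x) \<partial>weight_measure \<nu>)"
    using F laminar_cell sigma_finite_weights(3) sum_\<mu>_le[OF F E]
    by (intro Carleson_embedding) auto
  also have "\<dots> \<le> 2 * K * RH_const p ps \<sigma> * (\<integral>\<^sup>+x. (\<Prod>i\<in>UNIV. T i x epowr p) \<partial>weight_measure \<nu>)"
  proof (intro mult_left_mono nn_integral_mono SUP_least)
    fix x q assume "q \<in> F"
    show "c q * indicator (cell q) x \<le> (\<Prod>i\<in>UNIV. T i x epowr p)"
    proof (cases "x \<in> cell q")
      case True
      have "b i q \<le> T i x" for i
        unfolding T_def using \<open>q \<in> F\<close> True by (intro SUP_upper2[of q]) auto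
      with p True show ?thesis
        by (auto simp: c_def epowr_prod intro!: prod_mono_ennreal epowr_mono)
    qed simp
  qed simp
  \<comment> \<open>Both the density \<open>\<nu>\<close> and the factors
    \<open>T i x epowr p\<close> are written as powers with the exponents \<open>p / ps i\<close>,
    in preparation for Hoelder's inequality.\<close>
  also have "(\<integral>\<^sup>+x. (\<Prod>i\<in>UNIV. T i x epowr p) \<partial>weight_measure \<nu>)
      = (\<integral>\<^sup>+x. (\<Prod>i\<in>UNIV. (ennreal (\<sigma> i x) * T i x epowr ps i) epowr (p / ps i)) \<partial>lebesgue)"
  proof -
    have "ennreal (\<nu> x) = (\<Prod>i\<in>UNIV. ennreal (\<sigma> i x) epowr (p / ps i))" for x
      using weight_nonneg[OF weight_\<sigma>] by (simp add: \<nu>_def ennreal_epowr prod_ennreal)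
    moreover have "ps i * (p / ps i) = p" for i
      using ps[of i] by simp
    ultimately show ?thesis
      by (subst nn_integral_weight_measure, measurable)
         (simp add: epowr_mult epowr_epowr prod.distrib)
  qed
  also have "\<dots> \<le> (\<Prod>i\<in>UNIV. (\<integral>\<^sup>+x. ennreal (\<sigma> i x) * T i x epowr ps i \<partial>lebesgue) epowr (p / ps i))"
    using exponent_pos sum_exponents by (intro Holder_prod) auto
  also have "\<dots> \<le> (\<Prod>i\<in>UNIV. (ennreal (2 powr ps i * (ps i / (ps i - 1))) *
      (\<integral>\<^sup>+x. ennreal \<bar>f i x\<bar> epowr ps i \<partial>weight_measure (\<sigma> i))) epowr (p / ps i))"
  proof (intro prod_mono_ennreal epowr_mono)
    fix i
    have "(\<integral>\<^sup>+x. T i x epowr ps i \<partial>weight_measure (\<sigma> i)) \<le> ennreal (2 powr ps i * (ps i / (ps i - 1))) *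
        (\<integral>\<^sup>+x. ennreal \<bar>f i x\<bar> epowr ps i \<partial>weight_measure (\<sigma> i))"
      unfolding T_def b_def
    proof (intro laminar_maximal_inequality F laminar_cell sigma_finite_weights ps)
      show "emeasure (weight_measure (\<sigma> i)) (cell q) < \<infinity>" for q
        using mass_cube_finite[OF weight_\<sigma> closed_cell_mem_cubes, of i q]
        by (simp add: emeasure_weight_measure mass_cell)
    qed auto
    then show "(\<integral>\<^sup>+x. ennreal (\<sigma> i x) * T i x epowr ps i \<partial>lebesgue) \<le> ennreal (2 powr ps i * (ps i / (ps i - 1))) *
        (\<integral>\<^sup>+x. ennreal \<bar>f i x\<bar> epowr ps i \<partial>weight_measure (\<sigma> i))"
      by (subst (asm) nn_integral_weight_measure) measurable
  qed (use exponent_pos in \<open>auto simp: less_imp_le\<close>)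
  also have "\<dots> = maximal_const ps p * (\<Prod>i\<in>UNIV. (\<integral>\<^sup>+x. ennreal \<bar>f i x\<bar> epowr ps i \<partial>weight_measure (\<sigma> i)) epowr (p / ps i))"
    by (simp add: maximal_const_def epowr_mult prod.distrib)
  finally show ?thesis
    by (simp add: avg_def mult_left_mono)
qed

text \<open>The cells are countable and the bound for finite families does not depend on the family,
  so monotone convergence applies.\<close>

lemma grid_maximal_bound:
  assumes f: "\<And>i. f i \<in> borel_measurable lebesgue"
  shows "(\<integral>\<^sup>+x. grid_maximal (\<lambda>i y. f i y * \<sigma> i y) x epowr p \<partial>weight_measure \<omega>)
    \<le> 2 * K * RH_const p ps \<sigma> *
      (maximal_const ps p * (\<Prod>i\<in>UNIV. (\<integral>\<^sup>+x. ennreal \<bar>f i x\<bar> epowr ps i \<partial>weight_measure (\<sigma> i)) epowr (p / ps i)))"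
    (is "_ \<le> ?B")
proof -
  define a where "a q x = (\<Prod>i\<in>UNIV. average (\<lambda>y. \<bar>f i y * \<sigma> i y\<bar>) (closed_cell q)) * indicator (cell q) x" for q x
  have [measurable]: "a q \<in> borel_measurable lebesgue" for q
    unfolding a_def by measurable
  define F :: "nat \<Rightarrow> (int \<times> (int ^ 'd)) set" where "F n = from_nat ` {..n}" for n
  have UN_F: "(\<Union>n. F n) = UNIV"
  proof (safe intro!: UNIV_I)
    fix q show "q \<in> (\<Union>n. F n)"
      by (auto simp: F_def intro!: exI[of _ "to_nat q"] image_eqI[of _ _ "to_nat q"])
  qed
  have "grid_maximal (\<lambda>i y. f i y * \<sigma> i y) x epowr p = (SUP n. (SUP q\<in>F n. a q x) epowr p)" for x
  proof -
    have "grid_maximal (\<lambda>i y. f i y * \<sigma> i y) x = (SUP q\<in>(\<Union>n. F n). a q x)"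
      by (simp add: grid_maximal_def a_def UN_F)
    also have "\<dots> = (SUP n. SUP q\<in>F n. a q x)"
      by (rule SUP_UNION)
    finally show ?thesis
      using p by (simp add: epowr_SUP)
  qed
  then have "(\<integral>\<^sup>+x. grid_maximal (\<lambda>i y. f i y * \<sigma> i y) x epowr p \<partial>weight_measure \<omega>) =
      (\<integral>\<^sup>+x. (SUP n. (SUP q\<in>F n. a q x) epowr p) \<partial>weight_measure \<omega>)"
    by simp
  also have "\<dots> = (SUP n. \<integral>\<^sup>+x. (SUP q\<in>F n. a q x) epowr p \<partial>weight_measure \<omega>)"
  proof (rule nn_integral_monotone_convergence_SUP)
    show "incseq (\<lambda>n x. (SUP q\<in>F n. a q x) epowr p)"
      using p by (intro incseq_SucI le_funI epowr_mono SUP_subset_mono) (auto simp: F_def)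
    show "(\<lambda>x. (SUP q\<in>F n. a q x) epowr p) \<in> borel_measurable (weight_measure \<omega>)" for n
      by (intro borel_measurable_epowr borel_measurable_SUP) (auto simp: F_def)
  qed
  also have "\<dots> \<le> ?B"
    unfolding a_def by (intro SUP_least grid_maximal_bound_finite f) (simp add: F_def)
  finally show ?thesis .
qed

end

section \<open>Choice of the constants and summation over the shifted grids\<close>

theorem theorem1p9:
  fixes ps :: "'m::finite \<Rightarrow> real" and p \<rho> :: real
  assumes "\<And>i. 1 < ps i"
    and "0 < p" and "1 / p = (\<Sum>i\<in>UNIV. 1 / ps i)"
    and "1 < \<rho>"
  shows "\<exists>D C1 C2 :: real. 1 < D \<and> 0 < C1 \<and> 0 < C2 \<and>
    (\<forall>(\<omega> :: real ^ 'd \<Rightarrow> real) (\<sigma> :: 'm \<Rightarrow> real ^ 'd \<Rightarrow> real).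
      weight \<omega> \<and> (\<forall>i. weight (\<sigma> i)) \<and> RH p ps \<sigma> \<longrightarrow>
        A_const p ps \<omega> \<sigma> + parent_testing_const p ps \<rho> D \<omega> \<sigma> \<le> ennreal C1 * N_const p ps \<omega> \<sigma> \<and>
        N_const p ps \<omega> \<sigma> \<le>
          ennreal C2 * (A_const p ps \<omega> \<sigma> + parent_testing_const p ps \<rho> D \<omega> \<sigma>) * RH_const p ps \<sigma>)"
proof -
  \<comment> \<open>At least 3, as the shifted grids require, and at least \<open>\<rho>\<close>, so
    that grid parents are long enough.\<close>
  define N where "N = max 3 (nat \<lceil>\<rho>\<rceil>)"
  have N: "3 \<le> N" "\<rho> \<le> real N"
    unfolding N_def by linarith+
  define D0 where "D0 = 2 * real N ^ CARD('d)"
  define c where "c = ((real N ^ 2) ^ CARD('d)) ^ CARD('m)"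
  \<comment> \<open>The factors come from the comparison with the grids, the number of shifts, the
    packing bound and the maximal inequalities.\<close>
  define C where "C = ennreal c epowr p * of_nat CARD('d set) * 2 * maximal_const ps p"
  have "C < top"
    using maximal_const_finite[of ps p] of_nat_less_top[of "CARD('d set)"]
    by (simp add: C_def ennreal_mult_less_top)
  have "1 \<le> real N ^ CARD('d)"
    using N(1) by (intro one_le_power) simp
  then have D0: "1 < D0"
    unfolding D0_def by linarith
  \<comment> \<open>Adding 1 ensures that the constant is positive.\<close>
  define C2 where "C2 = enn2real C + 1"
  have C2: "C \<le> ennreal C2" "0 < C2"
  proof -
    have "C = ennreal (enn2real C)"
      using \<open>C < top\<close> by simp
    also have "\<dots> \<le> ennreal C2"
      unfolding C2_def by (intro ennreal_leI) simp
    finally show "C \<le> ennreal C2" .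
    show "0 < C2"
      unfolding C2_def using enn2real_nonneg[of C] by linarith
  qed
  have main: "A_const p ps \<omega> \<sigma> + parent_testing_const p ps \<rho> D0 \<omega> \<sigma> \<le> ennreal 2 * N_const p ps \<omega> \<sigma> \<and>
      N_const p ps \<omega> \<sigma> \<le>
        ennreal C2 * (A_const p ps \<omega> \<sigma> + parent_testing_const p ps \<rho> D0 \<omega> \<sigma>) * RH_const p ps \<sigma>"
    if weights: "weight \<omega>" "\<And>i. weight (\<sigma> i)" and RH: "RH p ps \<sigma>"
    for \<omega> :: "real ^ 'd \<Rightarrow> real" and \<sigma> :: "'m \<Rightarrow> real ^ 'd \<Rightarrow> real"
  proof
    interpret weight_tuple ps p \<omega> \<sigma>
      by standard (use assms weights in auto)
    show "A_const p ps \<omega> \<sigma> + parent_testing_const p ps \<rho> D0 \<omega> \<sigma> \<le> ennreal 2 * N_const p ps \<omega> \<sigma>"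
      using A_plus_testing_le_N_const[of \<rho> D0] by simp
    define T where "T = A_const p ps \<omega> \<sigma> + parent_testing_const p ps \<rho> D0 \<omega> \<sigma>"
    have "N_const p ps \<omega> \<sigma> \<le> C * T * RH_const p ps \<sigma>"
      unfolding N_const_def
    proof (intro Inf_lower CollectI allI impI)
      fix f :: "'m \<Rightarrow> real ^ 'd \<Rightarrow> real"
      assume "\<forall>i. f i \<in> Lspace (ps i) (\<sigma> i)"
      then have f: "f i \<in> borel_measurable lebesgue" for i
        by (auto simp: Lspace_def cong: measurable_cong_sets)
      define X where "X = (\<Prod>i\<in>UNIV. (\<integral>\<^sup>+x. ennreal \<bar>f i x\<bar> epowr ps i \<partial>weight_measure (\<sigma> i)) epowr (p / ps i))"
      define G where "G S = nadic_grid.grid_maximal N S (\<lambda>i y. f i y * \<sigma> i y)" for S :: "'d set"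
      have [measurable]: "G S \<in> borel_measurable lebesgue" for S
        unfolding G_def by (intro nadic_grid.borel_measurable_grid_maximal nadic_grid.intro N)
      have grid: "(\<integral>\<^sup>+x. G S x epowr p \<partial>weight_measure \<omega>) \<le> 2 * T * RH_const p ps \<sigma> * (maximal_const ps p * X)" for S
      proof -
        interpret grid_weights N S ps p \<omega> \<sigma> \<rho>
          by standard (use N RH in auto)
        show ?thesis
          using grid_maximal_bound[of f] f by (simp add: G_def X_def T_def D0_def K_def D_def)
      qed
      have "Lnorm p \<omega> (\<M> (\<lambda>i y. f i y * \<sigma> i y)) epowr p
          = (\<integral>\<^sup>+x. \<M> (\<lambda>i y. f i y * \<sigma> i y) x epowr p \<partial>weight_measure \<omega>)"
        using p by (rule Lnorm_powr)
      also have "\<dots> \<le> (\<integral>\<^sup>+x. ennreal c epowr p * (\<Sum>S\<in>UNIV. G S x epowr p) \<partial>weight_measure \<omega>)"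
      proof (rule nn_integral_mono)
        fix x
        have "\<M> (\<lambda>i y. f i y * \<sigma> i y) x epowr p \<le> (ennreal c * (SUP S. G S x)) epowr p"
          unfolding c_def G_def using p by (intro epowr_mono maximal_le_grid_maximal N) auto
        also have "\<dots> = ennreal c epowr p * (SUP S. G S x epowr p)"
          using p by (simp add: epowr_mult epowr_SUP)
        \<comment> \<open>There are finitely many shifts, so the supremum over them is at most the
          sum, which commutes with the integral.\<close>
        also have "\<dots> \<le> ennreal c epowr p * (\<Sum>S\<in>UNIV. G S x epowr p)"
          by (intro mult_left_mono SUP_least member_le_sum) auto
        finally show "\<M> (\<lambda>i y. f i y * \<sigma> i y) x epowr p \<le> ennreal c epowr p * (\<Sum>S\<in>UNIV. G S x epowr p)" .
      qed
      also have "\<dots> = ennreal c epowr p * (\<Sum>S\<in>UNIV. \<integral>\<^sup>+x. G S x epowr p \<partial>weight_measure \<omega>)"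
        by (simp add: nn_integral_cmult nn_integral_sum)
      also have "\<dots> \<le> ennreal c epowr p * (\<Sum>S\<in>(UNIV :: 'd set set). 2 * T * RH_const p ps \<sigma> * (maximal_const ps p * X))"
        by (intro mult_left_mono sum_mono grid) auto
      also have "\<dots> = C * T * RH_const p ps \<sigma> * X"
        by (simp only: sum_constant C_def ac_simps)
      also have "X = (\<Prod>i\<in>UNIV. Lnorm (ps i) (\<sigma> i) (\<lambda>x. ennreal \<bar>f i x\<bar>) epowr p)"
        unfolding X_def Lnorm_def by (simp add: epowr_epowr)
      finally show "Lnorm p \<omega> (\<M> (\<lambda>i y. f i y * \<sigma> i y)) epowr p
          \<le> C * T * RH_const p ps \<sigma> * (\<Prod>i\<in>UNIV. Lnorm (ps i) (\<sigma> i) (\<lambda>x. ennreal \<bar>f i x\<bar>) epowr p)" .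
    qed
    also have "\<dots> \<le> ennreal C2 * T * RH_const p ps \<sigma>"
      by (intro mult_right_mono C2) auto
    finally show "N_const p ps \<omega> \<sigma> \<le>
        ennreal C2 * (A_const p ps \<omega> \<sigma> + parent_testing_const p ps \<rho> D0 \<omega> \<sigma>) * RH_const p ps \<sigma>"
      by (simp add: T_def)
  qed
  have "(0 :: real) < 2" by simp
  with D0 C2(2) main show ?thesis
    by blast
qed

end
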